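(* Let $\Phi:\mathbb{M}_k\to\mathbb{M}_n$ and $\Psi:\mathbb{M}_m\to\mathbb{M}_n$ be unital positive linear maps, let $K\in\mathbb{M}_n$, and let $f_1,f_2$ be nonnegative operator monotone functions on $(0,\infty)$. Then (i) the map $(A,B)\mapsto\mathrm{Tr}\{\Phi(f_1(A))^pK^*\Psi(f_2(B))^{1-p}K\}$ on positive definite $A\in\mathbb{M}_k$, $B\in\mathbb{M}_m$ is jointly concave for all $0\le p\le1$; (ii) the map $(A,B)\mapsto\mathrm{Tr}\{\Phi(f_1(A))^pK^*\Psi(f_2(B))^{-1-p}K\}$ on positive definite $A\in\mathbb{M}_k$, $B\in\mathbb{M}_m$ is jointly convex for all $-1\le p\le0$.
   Context: $\mathbb{M}_n$ denotes $n\times n$ complex matrices, $\mathrm{Tr}$ the trace, $\le$ the Löwner order. Positive linear maps preserve positive semidefiniteness; unital means $\Phi(I)=I$. $f$ operator monotone: $X\le Y\Rightarrow f(X)\le f(Y)$. Jointly convex means $T((1-\lambda)A_1+\lambda A_2,(1-\lambda)B_1+\lambda B_2)\le(1-\lambda)T(A_1,B_1)+\lambda T(A_2,B_2)$ for $\lambda\in[0,1]$; jointly concave means the reverse inequality. *)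

theory Defs
  imports Complex_Main "Jordan_Normal_Form.Matrix"
begin

definition cadj :: "complex mat \<Rightarrow> complex mat" where
  "cadj A = Matrix.mat (dim_col A) (dim_row A) (\<lambda>(i,j). cnj (A $$ (j,i)))"

definition mtrace :: "complex mat \<Rightarrow> complex" where
  "mtrace A = (\<Sum>i<dim_row A. A $$ (i,i))"

definition qform :: "complex mat \<Rightarrow> complex vec \<Rightarrow> complex" where
  "qform A x = (\<Sum>i<dim_vec x. cnj (x $ i) * (A *\<^sub>v x) $ i)"

definition hermitian :: "nat \<Rightarrow> complex mat \<Rightarrow> bool" where
  "hermitian n A \<longleftrightarrow> A \<in> carrier_mat n n \<and> cadj A = A"

definition psd :: "nat \<Rightarrow> complex mat \<Rightarrow> bool" where
  "psd n A \<longleftrightarrow> hermitian n A \<and>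
     (\<forall>x \<in> carrier_vec n. Im (qform A x) = 0 \<and> Re (qform A x) \<ge> 0)"

definition pd :: "nat \<Rightarrow> complex mat \<Rightarrow> bool" where
  "pd n A \<longleftrightarrow> psd n A \<and> (\<forall>x \<in> carrier_vec n. x \<noteq> 0\<^sub>v n \<longrightarrow> Re (qform A x) > 0)"

definition loewner_le :: "nat \<Rightarrow> complex mat \<Rightarrow> complex mat \<Rightarrow> bool" where
  "loewner_le n A B \<longleftrightarrow> A \<in> carrier_mat n n \<and> B \<in> carrier_mat n n \<and> psd n (B - A)"

definition unitary :: "nat \<Rightarrow> complex mat \<Rightarrow> bool" where
  "unitary n U \<longleftrightarrow> U \<in> carrier_mat n n \<and> cadj U * U = 1\<^sub>m n"

definition mat_fun :: "(real \<Rightarrow> real) \<Rightarrow> complex mat \<Rightarrow> complex mat" where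
  "mat_fun f A = (let n = dim_row A;
      (U, d) = (SOME (U, d). unitary n U \<and>
                   A = U * mat_diag n (\<lambda>i. complex_of_real (d i)) * cadj U)
    in U * mat_diag n (\<lambda>i. complex_of_real (f (d i))) * cadj U)"

text \<open>Real powers of positive semidefinite matrices, with the convention X^0 = I.\<close>
definition mat_rpow :: "complex mat \<Rightarrow> real \<Rightarrow> complex mat" where
  "mat_rpow X p = mat_fun (\<lambda>t. if p = 0 then 1 else t powr p) X"

definition operator_monotone_pos :: "(real \<Rightarrow> real) \<Rightarrow> bool" where
  "operator_monotone_pos f \<longleftrightarrow>
     (\<forall>n X Y. pd n X \<and> pd n Y \<and> loewner_le n X Y \<longrightarrow>
              loewner_le n (mat_fun f X) (mat_fun f Y))"

definition linear_mat_map :: "nat \<Rightarrow> nat \<Rightarrow> (complex mat \<Rightarrow> complex mat) \<Rightarrow> bool" where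
  "linear_mat_map k n \<Phi> \<longleftrightarrow>
     (\<forall>A \<in> carrier_mat k k. \<Phi> A \<in> carrier_mat n n) \<and>
     (\<forall>A \<in> carrier_mat k k. \<forall>B \<in> carrier_mat k k. \<Phi> (A + B) = \<Phi> A + \<Phi> B) \<and>
     (\<forall>c. \<forall>A \<in> carrier_mat k k. \<Phi> (c \<cdot>\<^sub>m A) = c \<cdot>\<^sub>m \<Phi> A)"

definition positive_map :: "nat \<Rightarrow> nat \<Rightarrow> (complex mat \<Rightarrow> complex mat) \<Rightarrow> bool" where
  "positive_map k n \<Phi> \<longleftrightarrow> (\<forall>A. psd k A \<longrightarrow> psd n (\<Phi> A))"

definition unital_map :: "nat \<Rightarrow> nat \<Rightarrow> (complex mat \<Rightarrow> complex mat) \<Rightarrow> bool" where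
  "unital_map k n \<Phi> \<longleftrightarrow> \<Phi> (1\<^sub>m k) = 1\<^sub>m n"

definition jointly_concave_on ::
  "complex mat set \<Rightarrow> complex mat set \<Rightarrow> (complex mat \<Rightarrow> complex mat \<Rightarrow> real) \<Rightarrow> bool" where
  "jointly_concave_on S T F \<longleftrightarrow>
     (\<forall>A1\<in>S. \<forall>A2\<in>S. \<forall>B1\<in>T. \<forall>B2\<in>T. \<forall>l::real. 0 \<le> l \<and> l \<le> 1 \<longrightarrow>
        (1 - l) * F A1 B1 + l * F A2 B2
          \<le> F (complex_of_real (1 - l) \<cdot>\<^sub>m A1 + complex_of_real l \<cdot>\<^sub>m A2)
              (complex_of_real (1 - l) \<cdot>\<^sub>m B1 + complex_of_real l \<cdot>\<^sub>m B2))"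

definition jointly_convex_on ::
  "complex mat set \<Rightarrow> complex mat set \<Rightarrow> (complex mat \<Rightarrow> complex mat \<Rightarrow> real) \<Rightarrow> bool" where
  "jointly_convex_on S T F \<longleftrightarrow>
     (\<forall>A1\<in>S. \<forall>A2\<in>S. \<forall>B1\<in>T. \<forall>B2\<in>T. \<forall>l::real. 0 \<le> l \<and> l \<le> 1 \<longrightarrow>
        F (complex_of_real (1 - l) \<cdot>\<^sub>m A1 + complex_of_real l \<cdot>\<^sub>m A2)
          (complex_of_real (1 - l) \<cdot>\<^sub>m B1 + complex_of_real l \<cdot>\<^sub>m B2)
        \<le> (1 - l) * F A1 B1 + l * F A2 B2)"

end

theory Submission
  imports "HOL-Analysis.Equivalence_Lebesgue_Henstock_Integration" "Jordan_Normal_Form.Schur_Decomposition" Defs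
begin

text \<open>A nonnegative operator monotone function is operator concave: rotate the direct sum of A and B so
  that the convex combination appears as a corner, bound the off-diagonal blocks, and compare. Hence
  A \<mapsto> \<Phi> (f1 A) and B \<mapsto> \<Psi> (f2 B) are concave in the Loewner order, and it remains to see that
  Tr (X^p K* Y^(1-p) K) is jointly concave and increasing, and Tr (X^p K* Y^(-1-p) K) jointly convex
  and decreasing, in positive definite X and Y.

  In eigenbases of X and Y both traces are sums of h x y |m|^2 over the eigenvalues x of X and y of Y,
  where h x y is x^p y^(1-p) or x^p y^(-1-p). Up to a common constant these h are the integrals over
  t > 0 of t^(p-1) x y / (x + t y), respectively t^p / (x + t y). For fixed t the first kernel is a
  minimum, x y / (x + t y) |m|^2 = min_z (x |z|^2 / t + y |m - z|^2), and the second a maximum,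
  |m|^2 / (x + t y) = max_z (2 Re (m z*) - (x + t y) |z|^2). At the level of matrices these are
  extrema over a matrix Z of expressions that are affine and monotone in (X, Y), which gives joint
  concavity (convexity) and monotonicity at once. The extreme values of p follow by continuity.\<close>

unbundle no vec_syntax
no_notation inner (infix "\<bullet>" 70)

section \<open>Spectral decomposition and functional calculus\<close>


text \<open>Operator monotonicity comes without any continuity of f, while bounding the off-diagonal
  blocks costs a factor 1 + \<delta> inside the argument of f. Letting \<delta> tend to 0 there
  would need continuity. The 1-by-1 case of the same block inequality supplies a substitute: with
  the nonnegative value of f at one of the two points dropped, it bounds f at (1 + \<delta>) t by (1
  + \<delta>)^3 times f at t. The factor then stands outside f, where the limit is harmless. The
  same growth bound spreads a single zero of f to all of (0,\<infinity>), so the images under the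
  unital maps are either positive definite, where the kernels apply, or zero.

  The second obstacle is that the three points of a concavity inequality have unrelated eigenbases,
  so their kernel sums cannot be compared term by term. The matrix Z carries the comparison: it is
  chosen in the eigenbases of one point, but the traces it enters involve X and Y separately and
  linearly, so the same Z can be tried at the other two points.\<close>

lemma cadj_dim[simp]: "dim_row (cadj A) = dim_col A" "dim_col (cadj A) = dim_row A"
  by (auto simp: cadj_def)

lemma cadj_carrier[simp, intro]: "A \<in> carrier_mat r c \<Longrightarrow> cadj A \<in> carrier_mat c r"
  by (auto simp: cadj_def)

lemma cadj_index[simp]: "i < dim_col A \<Longrightarrow> j < dim_row A \<Longrightarrow> cadj A $$ (i,j) = cnj (A $$ (j,i))"
  by (auto simp: cadj_def)

lemma cadj_cadj[simp]: "cadj (cadj A) = A"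
  by (rule eq_matI) auto

lemma cadj_mult: "dim_col A = dim_row B \<Longrightarrow> cadj (A * B) = cadj B * cadj A"
  by (rule eq_matI) (auto simp: scalar_prod_def intro!: sum.cong)

lemma cadj_add: "A \<in> carrier_mat r c \<Longrightarrow> B \<in> carrier_mat r c \<Longrightarrow> cadj (A + B) = cadj A + cadj B"
  by (rule eq_matI) auto

lemma cadj_minus: "A \<in> carrier_mat r c \<Longrightarrow> B \<in> carrier_mat r c \<Longrightarrow> cadj (A - B) = cadj A - cadj B"
  by (rule eq_matI) auto

lemma cadj_smult: "cadj (c \<cdot>\<^sub>m A) = cnj c \<cdot>\<^sub>m cadj A"
  by (rule eq_matI) auto

lemma cadj_one[simp]: "cadj (1\<^sub>m n) = 1\<^sub>m n"
  by (rule eq_matI) auto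

lemma mat_diag_index[simp]: "i < n \<Longrightarrow> j < n \<Longrightarrow> mat_diag n d $$ (i,j) = (if i = j then d j else 0)"
  by (auto simp: mat_diag_def)

lemma mat_diag_dims[simp]: "dim_row (mat_diag n d) = n" "dim_col (mat_diag n d) = n"
  by (auto simp: mat_diag_def)

lemma cadj_mat_diag: "cadj (mat_diag n d) = mat_diag n (\<lambda>i. cnj (d i))"
  by (rule eq_matI) (auto simp: mat_diag_def)

abbreviation rdiag :: "nat \<Rightarrow> (nat \<Rightarrow> real) \<Rightarrow> complex mat" where
  "rdiag n d \<equiv> mat_diag n (\<lambda>i. complex_of_real (d i))"

text \<open>The condition under the choice operator in \<open>mat_fun\<close>, turned into a
  relation so that a decomposition built by hand can stand in for the chosen one.\<close>

definition spectral :: "nat \<Rightarrow> complex mat \<Rightarrow> complex mat \<Rightarrow> (nat \<Rightarrow> real) \<Rightarrow> bool" where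
  "spectral n A U d \<longleftrightarrow> unitary n U \<and> A = U * rdiag n d * cadj U"

lemma mult_mat_assoc:
  fixes A B C :: "complex mat"
  shows "dim_col A = dim_row B \<Longrightarrow> dim_col B = dim_row C \<Longrightarrow> A * B * C = A * (B * C)"
  by (rule assoc_mult_mat[of _ "dim_row A" "dim_row B" _ "dim_row C" _ "dim_col C"]) auto

lemma unitary_dims: "unitary n U \<Longrightarrow> dim_row U = n" "unitary n U \<Longrightarrow> dim_col U = n"
  by (auto simp: unitary_def)

lemma unitaryD:
  assumes "unitary n U"
  shows "U \<in> carrier_mat n n" "cadj U * U = 1\<^sub>m n" "U * cadj U = 1\<^sub>m n"
  using assms mat_mult_left_right_inverse[of "cadj U" n U] by (auto simp: unitary_def)

lemma unitary_cancel:
  assumes "unitary n U" "dim_row X = n"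
  shows "cadj U * (U * X) = X" "U * (cadj U * X) = X"
proof -
  have U: "dim_row U = n" "dim_col U = n" using unitary_dims[OF assms(1)] by auto
  have "cadj U * (U * X) = (cadj U * U) * X"
    by (rule mult_mat_assoc[symmetric]) (use U assms in auto)
  also have "\<dots> = X" using unitaryD[OF assms(1)] assms(2) by simp
  finally show "cadj U * (U * X) = X" .
  have "U * (cadj U * X) = (U * cadj U) * X"
    by (rule mult_mat_assoc[symmetric]) (use U assms in auto)
  also have "\<dots> = X" using unitaryD[OF assms(1)] assms(2) by simp
  finally show "U * (cadj U * X) = X" .
qed

lemma unitary_mult:
  assumes U: "unitary n U" and V: "unitary n V"
  shows "unitary n (U * V)"
proof -
  have "cadj (U * V) * (U * V) = cadj V * (cadj U * (U * V))"
    using unitary_dims[OF U] unitary_dims[OF V] by (simp add: cadj_mult mult_mat_assoc)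
  also have "\<dots> = 1\<^sub>m n"
    using unitary_cancel(1)[OF U, of V] unitary_dims[OF V] unitaryD(2)[OF V] by simp
  finally show ?thesis using unitaryD(1)[OF U] unitaryD(1)[OF V] by (simp add: unitary_def)
qed

lemma unitary_cadj: "unitary n U \<Longrightarrow> unitary n (cadj U)"
  using unitaryD(3)[of n U] by (simp add: unitary_def)

lemma unitary_one: "unitary n (1\<^sub>m n)"
  by (auto simp: unitary_def)

lemma spectral_carrier: "spectral n A U d \<Longrightarrow> A \<in> carrier_mat n n"
  unfolding spectral_def using unitaryD(1) mat_diag_dim by (metis mult_carrier_mat cadj_carrier)

lemma spectral_rdiag: "spectral n (rdiag n d) (1\<^sub>m n) d"
  unfolding spectral_def by (auto simp: unitary_one left_mult_one_mat[of _ n n] right_mult_one_mat[of _ n n])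

lemma spectral_conj:
  assumes W: "unitary n W" and s: "spectral n B V e"
  shows "spectral n (W * B * cadj W) (W * V) e"
proof -
  have V: "unitary n V" using s by (simp add: spectral_def)
  show ?thesis
    using s unitary_dims[OF W] unitary_mult[OF W V] unitary_dims[OF V]
    by (auto simp: spectral_def cadj_mult mult_mat_assoc)
qed

lemma spectral_hermitian:
  assumes "spectral n A U d"
  shows "hermitian n A"
proof -
  have U: "unitary n U" "A = U * rdiag n d * cadj U" using assms by (auto simp: spectral_def)
  show ?thesis
    using spectral_carrier[OF assms] unitary_dims[OF U(1)]
    by (auto simp: hermitian_def U(2) cadj_mult mult_mat_assoc cadj_mat_diag)
qed

text \<open>The entries of cadj V * U intertwine the two eigenvalue lists, hence also their images under f;
  so the choice made in mat_fun is immaterial.\<close>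
lemma spectral_fun_unique:
  assumes "spectral n A U d" "spectral n A V e"
  shows "U * rdiag n (\<lambda>i. f (d i)) * cadj U = V * rdiag n (\<lambda>i. f (e i)) * cadj V"
proof -
  define W where "W = cadj V * U"
  have U: "unitary n U" "A = U * rdiag n d * cadj U" and V: "unitary n V" "A = V * rdiag n e * cadj V"
    using assms by (auto simp: spectral_def)
  note [simp] = unitary_dims[OF U(1)] unitary_dims[OF V(1)]
  have W: "W \<in> carrier_mat n n" by (auto simp: W_def)
  have "cadj V * A * U = W * rdiag n d"
    by (simp add: U(2) W_def mult_mat_assoc unitaryD[OF U(1)])
  moreover have "cadj V * A * U = rdiag n e * W"
    by (simp add: V(2) W_def mult_mat_assoc unitary_cancel[OF V(1)])
  ultimately have eq: "W * rdiag n d = rdiag n e * W" by simp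
  have "W * rdiag n (\<lambda>i. f (d i)) = rdiag n (\<lambda>i. f (e i)) * W"
  proof (rule eq_matI)
    fix i j assume "i < dim_row (rdiag n (\<lambda>i. f (e i)) * W)" "j < dim_col (rdiag n (\<lambda>i. f (e i)) * W)"
    hence ij: "i < n" "j < n" using W by auto
    have "(W * rdiag n d) $$ (i,j) = (rdiag n e * W) $$ (i,j)" using eq by simp
    hence "W $$ (i,j) * complex_of_real (d j) = complex_of_real (e i) * W $$ (i,j)"
      using ij W by (simp add: mat_diag_mult_left[OF W] mat_diag_mult_right[OF W])
    hence "W $$ (i,j) = 0 \<or> d j = e i"
      by (metis mult.commute mult_left_cancel of_real_eq_iff)
    thus "(W * rdiag n (\<lambda>i. f (d i))) $$ (i,j) = (rdiag n (\<lambda>i. f (e i)) * W) $$ (i,j)"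
      using ij W by (auto simp: mat_diag_mult_left[OF W] mat_diag_mult_right[OF W])
  qed (use W in auto)
  hence *: "V * (W * rdiag n (\<lambda>i. f (d i))) * cadj U = V * (rdiag n (\<lambda>i. f (e i)) * W) * cadj U"
    by simp
  thus ?thesis
    by (simp add: W_def mult_mat_assoc unitary_cancel[OF V(1)] unitaryD[OF U(1)] right_mult_one_mat[of _ n n])
qed

lemma mat_fun_spectral:
  assumes "spectral n A U d"
  shows "mat_fun f A = U * rdiag n (\<lambda>i. f (d i)) * cadj U"
proof -
  have n: "dim_row A = n" using spectral_carrier[OF assms] by auto
  let ?P = "\<lambda>(V, e). unitary n V \<and> A = V * rdiag n e * cadj V"
  obtain V e where Ve: "(SOME x. ?P x) = (V, e)" by fastforce
  have "?P (SOME x. ?P x)" by (rule someI[of ?P "(U,d)"]) (use assms in \<open>auto simp: spectral_def\<close>)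
  hence "spectral n A V e" unfolding Ve by (simp add: spectral_def)
  from spectral_fun_unique[OF assms this, of f] show ?thesis
    unfolding mat_fun_def n Let_def using Ve by simp
qed

lemma spectral_mat_fun:
  assumes "spectral n A U d"
  shows "spectral n (mat_fun f A) U (\<lambda>i. f (d i))"
  using assms mat_fun_spectral[OF assms, of f] by (auto simp: spectral_def)

section \<open>Block sums and their spectral decompositions\<close>

definition direct_sum :: "complex mat \<Rightarrow> complex mat \<Rightarrow> complex mat" where
  "direct_sum A B = four_block_mat A (0\<^sub>m (dim_row A) (dim_col B)) (0\<^sub>m (dim_row B) (dim_col A)) B"

lemma direct_sum_carrier: "A \<in> carrier_mat n n \<Longrightarrow> B \<in> carrier_mat m m \<Longrightarrow> direct_sum A B \<in> carrier_mat (n + m) (n + m)"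
  by (auto simp: direct_sum_def)

lemma direct_sum_mult:
  assumes "A \<in> carrier_mat n n" "B \<in> carrier_mat m m" "C \<in> carrier_mat n n" "D \<in> carrier_mat m m"
  shows "direct_sum A B * direct_sum C D = direct_sum (A * C) (B * D)"
  unfolding direct_sum_def
  using assms by (subst mult_four_block_mat[of _ n n _ m _ m _ _ n _ m]) auto

lemma cadj_direct_sum:
  assumes "A \<in> carrier_mat n n" "B \<in> carrier_mat m m"
  shows "cadj (direct_sum A B) = direct_sum (cadj A) (cadj B)"
  by (rule eq_matI) (use assms in \<open>auto simp: direct_sum_def\<close>)

lemma direct_sum_one: "direct_sum (1\<^sub>m n) (1\<^sub>m m) = 1\<^sub>m (n + m)"
  by (rule eq_matI) (auto simp: direct_sum_def)

lemma direct_sum_rdiag: "direct_sum (rdiag n d) (rdiag m e) = rdiag (n + m) (\<lambda>i. if i < n then d i else e (i - n))"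
  by (rule eq_matI) (auto simp: direct_sum_def)

lemma spectral_direct_sum:
  assumes A: "spectral n A U d" and B: "spectral m B V e"
  shows "spectral (n + m) (direct_sum A B) (direct_sum U V) (\<lambda>i. if i < n then d i else e (i - n))"
proof -
  have U: "unitary n U" "A = U * rdiag n d * cadj U" and V: "unitary m V" "B = V * rdiag m e * cadj V"
    using assms by (auto simp: spectral_def)
  note c = unitaryD[OF U(1)] unitaryD[OF V(1)]
  have "unitary (n + m) (direct_sum U V)"
    unfolding unitary_def using c
    by (auto simp: direct_sum_carrier cadj_direct_sum[OF c(1,4)] direct_sum_mult[of _ n _ m] direct_sum_one)
  moreover have "direct_sum A B = direct_sum U V * direct_sum (rdiag n d) (rdiag m e) * cadj (direct_sum U V)"
    using c unfolding U(2) V(2)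
    by (subst direct_sum_mult[of _ n _ m], auto simp: cadj_direct_sum[OF c(1,4)])
       (subst direct_sum_mult[of _ n _ m], auto)
  ultimately show ?thesis by (simp add: spectral_def direct_sum_rdiag)
qed

section \<open>The spectral theorem for Hermitian matrices\<close>

lemma unitary_first_column:
  assumes v: "v \<in> carrier_vec n" and v0: "v \<noteq> 0\<^sub>v n" and n: "0 < n"
  obtains U c where "unitary n U" "col U 0 = c \<cdot>\<^sub>v v"
proof -
  interpret cof_vec_space n "TYPE(complex)" .
  define b where "b = basis_completion v"
  define ws where "ws = gram_schmidt n b"
  define W where "W = mat_of_cols n ws"
  from basis_completion[OF v v0, folded b_def]
  have b: "distinct b" "\<not> lin_dep (set b)" "set b \<subseteq> carrier_vec n" "hd b = v" "length b = n"
    by auto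
  then obtain vs where bv: "b = v # vs" using n by (cases b) auto
  from gram_schmidt_result[OF b(3) b(1) b(2) refl, folded ws_def]
  have ws: "set ws \<subseteq> carrier_vec n" "corthogonal ws" "length ws = n" by (auto simp: b)
  from gram_schmidt_hd[OF v, of vs, folded bv] have hdws: "hd ws = v" unfolding ws_def .
  have W: "W \<in> carrier_mat n n" using ws unfolding W_def by auto
  have orth: "corthogonal_mat W" using orthogonal_mat_of_cols ws unfolding W_def by auto
  have col0: "col W 0 = v"
    unfolding W_def using ws n hdws v by (subst col_mat_of_cols) (auto simp: hd_conv_nth)
  define q where "q i = (\<Sum>k<n. (cmod (W $$ (k,i)))\<^sup>2)" for i
  have ip: "(cadj W * W) $$ (i,j) = (if i = j then complex_of_real (q i) else 0)" if "i < n" "j < n" for i j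
  proof (cases "i = j")
    case False
    have "(cadj W * W) $$ (i,j) = col W j \<bullet>c col W i"
      using W that by (auto simp: scalar_prod_def mult.commute intro!: sum.cong)
    also have "\<dots> = 0" using corthogonal_matD[OF orth] that W False by auto
    finally show ?thesis using False by simp
  next
    case True
    have "(cadj W * W) $$ (i,i) = (\<Sum>k<n. cnj (W $$ (k,i)) * W $$ (k,i))"
      using W that by (auto simp: scalar_prod_def lessThan_atLeast0 intro!: sum.cong)
    also have "\<dots> = complex_of_real (q i)"
      by (simp add: q_def complex_norm_square mult.commute del: of_real_power)
    finally show ?thesis using True by simp
  qed
  have q: "q i > 0" if i: "i < n" for i
  proof -
    have "col W i \<bullet>c col W i \<noteq> 0" using corthogonal_matD[OF orth] that W by auto
    moreover have "col W i \<bullet>c col W i = (cadj W * W) $$ (i,i)"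
      using W that by (auto simp: scalar_prod_def mult.commute intro!: sum.cong)
    ultimately have "q i \<noteq> 0" using ip[OF i i] by auto
    moreover have "q i \<ge> 0" by (simp add: q_def sum_nonneg)
    ultimately show ?thesis by simp
  qed
  \<comment> \<open>The columns of \<open>W\<close> are orthogonal but not normalised, and column 0
    is \<open>v\<close> itself. Scaling column \<open>i\<close> by its inverse norm gives a unitary
    matrix and only rescales \<open>v\<close>.\<close>
  define U where "U = W * rdiag n (\<lambda>i. 1 / sqrt (q i))"
  have U: "U \<in> carrier_mat n n" "\<And>k i. k < n \<Longrightarrow> i < n \<Longrightarrow> U $$ (k,i) = W $$ (k,i) / sqrt (q i)"
    using W by (auto simp: U_def mat_diag_mult_right[OF W])
  have "cadj U * U = 1\<^sub>m n"
  proof (rule eq_matI)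
    fix i j assume "i < dim_row (1\<^sub>m n)" "j < dim_col (1\<^sub>m n)"
    hence ij: "i < n" "j < n" by auto
    have "(cadj U * U) $$ (i,j) = (\<Sum>k<n. cnj (W $$ (k,i)) * W $$ (k,j)) / (sqrt (q i) * sqrt (q j))"
      using U W ij by (auto simp: scalar_prod_def lessThan_atLeast0 sum_divide_distrib intro!: sum.cong)
    also have "(\<Sum>k<n. cnj (W $$ (k,i)) * W $$ (k,j)) = (cadj W * W) $$ (i,j)"
      using W ij by (auto simp: scalar_prod_def lessThan_atLeast0 intro!: sum.cong)
    finally have *: "(cadj U * U) $$ (i,j) = (cadj W * W) $$ (i,j) / (sqrt (q i) * sqrt (q j))" .
    show "(cadj U * U) $$ (i,j) = 1\<^sub>m n $$ (i,j)"
    proof (cases "i = j")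
      case True
      have "complex_of_real (q i) = complex_of_real (sqrt (q i)) * complex_of_real (sqrt (q i))"
        using q[of i] ij by (metis of_real_mult real_sqrt_mult_self abs_of_pos)
      hence "(cadj U * U) $$ (i,j) = 1"
        unfolding * ip[OF ij] using True ij q[of i] by simp
      thus ?thesis using True ij by simp
    qed (use ij in \<open>simp add: * ip\<close>)
  qed (use U in auto)
  hence "unitary n U" using U by (simp add: unitary_def)
  moreover have "col U 0 = (1 / sqrt (q 0)) \<cdot>\<^sub>v v"
    unfolding col0[symmetric] by (rule eq_vecI) (use U W n in auto)
  ultimately show ?thesis using that by blast
qed

text \<open>The characteristic polynomial splits into \<open>n\<close> linear factors over the
  complex numbers, so it has a root once \<open>n\<close> is positive.\<close>

lemma hermitian_eigenvector:
  assumes A: "A \<in> carrier_mat n n" and n: "0 < (n::nat)"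
  obtains v e where "v \<in> carrier_vec n" "v \<noteq> 0\<^sub>v n" "A *\<^sub>v v = (e::complex) \<cdot>\<^sub>v v"
proof -
  obtain as where as: "char_poly A = (\<Prod> a \<leftarrow> as. [:- a, 1:])" "length as = n"
    using char_poly_factorized[OF A] by auto
  then obtain e as' where "as = e # as'" using n by (cases as) auto
  hence "eigenvalue A e" using as unfolding eigenvalue_root_char_poly[OF A] by auto
  thus ?thesis using that A unfolding eigenvalue_def eigenvector_def by auto
qed

text \<open>Deflation: in an orthonormal basis starting with an eigenvector, the first column of the
  matrix is a multiple of the first unit vector, and by symmetry so is the first row. A real 1-by-1
  block splits off, and the induction hypothesis treats the Hermitian remainder.\<close>

theorem hermitian_spectral:
  assumes "hermitian n A"
  obtains U d where "spectral n A U d"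
  using assms
proof (induction n arbitrary: A thesis)
  case 0
  hence "A = rdiag 0 (\<lambda>_. 0)" by (auto simp: hermitian_def mat_diag_def)
  thus ?case using 0(1) spectral_rdiag[of 0 "\<lambda>_. 0"] by metis
next
  case (Suc n)
  have A: "A \<in> carrier_mat (Suc n) (Suc n)" "cadj A = A" using Suc.prems by (auto simp: hermitian_def)
  obtain v e where v: "v \<in> carrier_vec (Suc n)" "v \<noteq> 0\<^sub>v (Suc n)" "A *\<^sub>v v = e \<cdot>\<^sub>v v"
    using hermitian_eigenvector[OF A(1)] by blast
  obtain U c where U: "unitary (Suc n) U" "col U 0 = c \<cdot>\<^sub>v v"
    using unitary_first_column[OF v(1,2)] by blast
  note Uc = unitaryD[OF U(1)] and [simp] = unitary_dims[OF U(1)]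
  define B where "B = cadj U * A * U"
  have B: "B \<in> carrier_mat (Suc n) (Suc n)" using A Uc by (auto simp: B_def)
  have hB: "cadj B = B" using A Uc by (auto simp: B_def cadj_mult mult_mat_assoc)
  have AB: "A = U * B * cadj U" 
    using A by (simp add: B_def mult_mat_assoc unitary_cancel[OF U(1)] Uc(3) right_mult_one_mat[of _ "Suc n" "Suc n"])
  have "A *\<^sub>v col U 0 = e \<cdot>\<^sub>v col U 0"
    unfolding U(2) mult_mat_vec[OF A(1) v(1)] v(3)
    by (simp only: smult_smult_assoc mult.commute)
  moreover have colB': "col B 0 = cadj U *\<^sub>v (A *\<^sub>v col U 0)"
  proof -
    have c: "cadj U * A \<in> carrier_mat (Suc n) (Suc n)" "col U 0 \<in> carrier_vec (Suc n)"
      using mult_carrier_mat[OF cadj_carrier[OF Uc(1)] A(1)] col_dim[of U 0]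
      by (simp_all only: unitary_dims[OF U(1)])
    have "col B 0 = (cadj U * A) *\<^sub>v col U 0"
      unfolding B_def by (rule col_mult2[OF c(1) Uc(1)]) simp
    also have "\<dots> = cadj U *\<^sub>v (A *\<^sub>v col U 0)"
      by (rule assoc_mult_mat_vec[OF cadj_carrier[OF Uc(1)] A(1) c(2)])
    finally show ?thesis .
  qed
  moreover have "cadj U *\<^sub>v (e \<cdot>\<^sub>v col U 0) = e \<cdot>\<^sub>v (cadj U *\<^sub>v col U 0)"
    using mult_mat_vec[OF cadj_carrier[OF Uc(1)]] col_dim[of U 0]
    by (simp only: unitary_dims[OF U(1)])
  moreover have "cadj U *\<^sub>v col U 0 = col (cadj U * U) 0"
    by (rule col_mult2[symmetric, OF cadj_carrier[OF Uc(1)] Uc(1)]) simp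
  ultimately have colB: "col B 0 = e \<cdot>\<^sub>v col (1\<^sub>m (Suc n)) 0" by (simp only: Uc)
  have B0: "B $$ (i,0) = (if i = 0 then e else 0)" if "i < Suc n" for i
    using arg_cong[OF colB, of "\<lambda>w. w $ i"] that B by auto
  have B0': "B $$ (0,i) = (if i = 0 then e else 0)" if "i < Suc n" for i
  proof -
    have "B $$ (0,i) = cadj B $$ (0,i)" by (simp add: hB)
    also have "\<dots> = cnj (B $$ (i,0))" using B that by auto
    finally have *: "B $$ (0,i) = cnj (B $$ (i,0))" .
    show ?thesis
    proof (cases "i = 0")
      case True
      thus ?thesis using B0[of 0] by simp
    qed (use B0[of i] that * in auto)
  qed
  have e: "e = complex_of_real (Re e)"
  proof -
    have "cadj B $$ (0,0) = cnj (B $$ (0,0))" using B by auto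
    hence "e = cnj e" using B0[of 0] by (simp add: hB)
    thus ?thesis by (metis Reals_cnj_iff of_real_Re)
  qed
  define B' where "B' = Matrix.mat n n (\<lambda>(i,j). B $$ (Suc i, Suc j))"
  have "hermitian n B'"
  proof -
    have "cadj B' = B'"
    proof (rule eq_matI)
      fix i j assume "i < dim_row B'" "j < dim_col B'"
      hence ij: "i < n" "j < n" by (auto simp: B'_def)
      have "cadj B $$ (Suc i, Suc j) = cnj (B $$ (Suc j, Suc i))" using B ij by auto
      thus "cadj B' $$ (i,j) = B' $$ (i,j)" using ij by (simp add: hB B'_def)
    qed (auto simp: B'_def)
    thus ?thesis by (auto simp: hermitian_def B'_def)
  qed
  then obtain V d where V: "spectral n B' V d" using Suc.IH by blast
  have "B = direct_sum (rdiag 1 (\<lambda>_. Re e)) B'"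
  proof (rule eq_matI)
    fix i j assume "i < dim_row (direct_sum (rdiag 1 (\<lambda>_. Re e)) B')" "j < dim_col (direct_sum (rdiag 1 (\<lambda>_. Re e)) B')"
    hence ij: "i < Suc n" "j < Suc n" by (auto simp: direct_sum_def B'_def)
    show "B $$ (i,j) = direct_sum (rdiag 1 (\<lambda>_. Re e)) B' $$ (i,j)"
      using ij B0[of i] B0'[of j] e by (cases i; cases j) (auto simp: direct_sum_def B'_def)
  qed (use B in \<open>auto simp: direct_sum_def B'_def\<close>)
  hence "\<exists>V d. spectral (Suc n) B V d"
    using spectral_direct_sum[OF spectral_rdiag[of 1 "\<lambda>_. Re e"] V] by auto
  then obtain V d where "spectral (Suc n) B V d" by blast
  from spectral_conj[OF U(1) this] AB Suc.prems(1) show ?case by auto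
qed

section \<open>Quadratic forms\<close>

lemma mult_mat_vec_sum:
  "i < dim_row A \<Longrightarrow> dim_vec x = dim_col A \<Longrightarrow> (A *\<^sub>v x) $ i = (\<Sum>k<dim_col A. A $$ (i,k) * x $ k)"
  by (auto simp: scalar_prod_def lessThan_atLeast0 intro!: sum.cong)

declare index_mult_mat_vec[simp del]

lemma cadj_inner:
  assumes "U \<in> carrier_mat r c" "x \<in> carrier_vec r" "y \<in> carrier_vec c"
  shows "(\<Sum>i<r. cnj (x $ i) * (U *\<^sub>v y) $ i) = (\<Sum>k<c. cnj ((cadj U *\<^sub>v x) $ k) * y $ k)"
proof -
  have "(\<Sum>i<r. cnj (x $ i) * (U *\<^sub>v y) $ i) = (\<Sum>i<r. \<Sum>k<c. cnj (x $ i) * (U $$ (i,k) * y $ k))"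
    using assms by (intro sum.cong refl) (simp add: mult_mat_vec_sum sum_distrib_left)
  also have "\<dots> = (\<Sum>k<c. \<Sum>i<r. cnj (x $ i) * (U $$ (i,k) * y $ k))" by (rule sum.swap)
  also have "\<dots> = (\<Sum>k<c. cnj ((cadj U *\<^sub>v x) $ k) * y $ k)"
    using assms
    by (intro sum.cong refl)
       (simp add: mult_mat_vec_sum sum_distrib_left sum_distrib_right mult_ac)
  finally show ?thesis .
qed

lemma qform_conj:
  assumes "W \<in> carrier_mat r c" "D \<in> carrier_mat r r" "x \<in> carrier_vec c"
  shows "qform (cadj W * D * W) x = qform D (W *\<^sub>v x)"
proof -
  have Wx: "W *\<^sub>v x \<in> carrier_vec r" using assms by auto
  have "(cadj W * D * W) *\<^sub>v x = cadj W *\<^sub>v (D *\<^sub>v (W *\<^sub>v x))"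
    using assoc_mult_mat_vec[OF mult_carrier_mat[OF cadj_carrier[OF assms(1)] assms(2)] assms(1,3)]
      assoc_mult_mat_vec[OF cadj_carrier[OF assms(1)] assms(2) Wx] by simp
  hence "qform (cadj W * D * W) x = (\<Sum>i<c. cnj (x $ i) * (cadj W *\<^sub>v (D *\<^sub>v (W *\<^sub>v x))) $ i)"
    using assms by (simp add: qform_def)
  also have "\<dots> = (\<Sum>k<r. cnj ((W *\<^sub>v x) $ k) * (D *\<^sub>v (W *\<^sub>v x)) $ k)"
    using cadj_inner[of "cadj W" c r x "D *\<^sub>v (W *\<^sub>v x)"] assms Wx by simp
  also have "\<dots> = qform D (W *\<^sub>v x)" using assms(1) by (simp add: qform_def)
  finally show ?thesis .
qed

lemma qform_rdiag:
  assumes "x \<in> carrier_vec n"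
  shows "qform (rdiag n d) x = complex_of_real (\<Sum>i<n. d i * (cmod (x $ i))\<^sup>2)"
proof -
  have "(rdiag n d *\<^sub>v x) $ i = complex_of_real (d i) * x $ i" if "i < n" for i
  proof -
    have "(rdiag n d *\<^sub>v x) $ i = (\<Sum>k<n. rdiag n d $$ (i,k) * x $ k)"
      using mult_mat_vec_sum[of i "rdiag n d" x] that assms by (simp)
    also have "\<dots> = (\<Sum>k<n. if k = i then complex_of_real (d i) * x $ i else 0)"
      using that by (intro sum.cong) auto
    finally show ?thesis using that by simp
  qed
  hence "qform (rdiag n d) x = (\<Sum>i<n. complex_of_real (d i) * (x $ i * cnj (x $ i)))"
    using assms by (simp add: qform_def mult_ac)
  thus ?thesis by (simp add: complex_norm_square del: of_real_power)
qed

lemma qform_spectral: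
  assumes s: "spectral n A U d" and x: "x \<in> carrier_vec n"
  shows "qform A x = complex_of_real (\<Sum>i<n. d i * (cmod ((cadj U *\<^sub>v x) $ i))\<^sup>2)"
proof -
  have U: "unitary n U" "A = cadj (cadj U) * rdiag n d * cadj U" using s by (auto simp: spectral_def)
  have c: "cadj U \<in> carrier_mat n n" using unitaryD(1)[OF U(1)] by auto
  have "qform A x = qform (rdiag n d) (cadj U *\<^sub>v x)"
    unfolding U(2) by (rule qform_conj[OF c mat_diag_dim x])
  thus ?thesis using c x by (simp add: qform_rdiag)
qed

lemma qform_add: "A \<in> carrier_mat n n \<Longrightarrow> B \<in> carrier_mat n n \<Longrightarrow> x \<in> carrier_vec n
    \<Longrightarrow> qform (A + B) x = qform A x + qform B x"
  by (simp add: qform_def add_mult_distrib_mat_vec sum.distrib distrib_left)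

lemma qform_smult: "A \<in> carrier_mat n n \<Longrightarrow> x \<in> carrier_vec n \<Longrightarrow> qform (c \<cdot>\<^sub>m A) x = c * qform A x"
  by (simp add: qform_def sum_distrib_left mult_ac mult_mat_vec_sum)

lemma qform_minus: "A \<in> carrier_mat n n \<Longrightarrow> B \<in> carrier_mat n n \<Longrightarrow> x \<in> carrier_vec n
    \<Longrightarrow> qform (A - B) x = qform A x - qform B x"
  by (simp add: qform_def minus_mult_distrib_mat_vec sum_subtractf right_diff_distrib)

lemma qform_smult_vec: "A \<in> carrier_mat n n \<Longrightarrow> x \<in> carrier_vec n
    \<Longrightarrow> qform A (complex_of_real c \<cdot>\<^sub>v x) = complex_of_real (c\<^sup>2) * qform A x"
  by (simp add: qform_def mult_mat_vec sum_distrib_left power2_eq_square mult_ac)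

abbreviation rqform :: "complex mat \<Rightarrow> complex vec \<Rightarrow> real" where
  "rqform A x \<equiv> Re (qform A x)"

lemma qform_zero_vec: "A \<in> carrier_mat n n \<Longrightarrow> qform A (0\<^sub>v n) = 0"
  by (auto simp: qform_def)

lemma qform_one: "x \<in> carrier_vec n \<Longrightarrow> qform (1\<^sub>m n) x = complex_of_real (\<Sum>i<n. (cmod (x $ i))\<^sup>2)"
  using qform_rdiag[of x n "\<lambda>_. 1"] by simp

lemma rqform_one_pos: "x \<in> carrier_vec n \<Longrightarrow> x \<noteq> 0\<^sub>v n \<Longrightarrow> rqform (1\<^sub>m n) x > 0"
proof -
  assume x: "x \<in> carrier_vec n" "x \<noteq> 0\<^sub>v n"
  then obtain i where "i < n" "x $ i \<noteq> 0" by (metis carrier_vecD eq_vecI index_zero_vec(1) index_zero_vec(2))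
  hence "(\<Sum>i<n. (cmod (x $ i))\<^sup>2) > 0" by (intro sum_pos2[of _ i]) auto
  thus ?thesis using x(1) by (simp only: qform_one Re_complex_of_real)
qed

lemma unitary_norm:
  assumes U: "unitary n U" and x: "x \<in> carrier_vec n"
  shows "(\<Sum>i<n. (cmod ((cadj U *\<^sub>v x) $ i))\<^sup>2) = rqform (1\<^sub>m n) x"
proof -
  have "spectral n (1\<^sub>m n) U (\<lambda>_. 1)"
    using unitaryD[OF U] by (auto simp: spectral_def U right_mult_one_mat[of _ n n])
  from qform_spectral[OF this x] show ?thesis by (simp only: Re_complex_of_real mult_1)
qed

section \<open>Positivity in terms of quadratic forms and of eigenvalues\<close>

lemma psdI: "hermitian n A \<Longrightarrow> (\<And>x. x \<in> carrier_vec n \<Longrightarrow> 0 \<le> rqform A x) \<Longrightarrow> psd n A"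
  unfolding psd_def using hermitian_spectral[of n A] qform_spectral Im_complex_of_real by metis

lemma pdI:
  assumes "hermitian n A" "\<And>x. x \<in> carrier_vec n \<Longrightarrow> x \<noteq> 0\<^sub>v n \<Longrightarrow> 0 < rqform A x"
  shows "pd n A"
proof -
  have A: "A \<in> carrier_mat n n" using assms by (simp add: hermitian_def)
  have "0 \<le> rqform A x" if "x \<in> carrier_vec n" for x
    using assms(2)[OF that] qform_zero_vec[OF A] by (cases "x = 0\<^sub>v n") auto
  thus ?thesis using psdI[OF assms(1)] assms(2) by (simp add: pd_def)
qed

lemma psdD: "psd n A \<Longrightarrow> hermitian n A" "psd n A \<Longrightarrow> A \<in> carrier_mat n n"
  "psd n A \<Longrightarrow> x \<in> carrier_vec n \<Longrightarrow> 0 \<le> rqform A x"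
  by (auto simp: psd_def hermitian_def)

lemma pdD: "pd n A \<Longrightarrow> hermitian n A" "pd n A \<Longrightarrow> A \<in> carrier_mat n n" "pd n A \<Longrightarrow> psd n A"
  "pd n A \<Longrightarrow> x \<in> carrier_vec n \<Longrightarrow> x \<noteq> 0\<^sub>v n \<Longrightarrow> 0 < rqform A x"
  by (auto simp: psd_def pd_def hermitian_def)

lemma hermitian_add: "hermitian n A \<Longrightarrow> hermitian n B \<Longrightarrow> hermitian n (A + B)"
  by (auto simp: hermitian_def cadj_add)

lemma hermitian_minus: "hermitian n A \<Longrightarrow> hermitian n B \<Longrightarrow> hermitian n (A - B)"
  by (auto simp: hermitian_def cadj_minus minus_carrier_mat)

lemma hermitian_smult: "hermitian n A \<Longrightarrow> hermitian n (complex_of_real c \<cdot>\<^sub>m A)"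
  by (auto simp: hermitian_def cadj_smult)

lemma spectral_nonneg_psd: "spectral n A U d \<Longrightarrow> (\<And>i. i < n \<Longrightarrow> 0 \<le> d i) \<Longrightarrow> psd n A"
  by (rule psdI) (auto simp: spectral_hermitian qform_spectral intro!: sum_nonneg simp del: of_real_sum index_mult_mat_vec)

text \<open>The witness is column \<open>i\<close> of \<open>U\<close>. Evaluating the form there
  turns sign conditions on \<open>A\<close> into sign conditions on its eigenvalues.\<close>

lemma spectral_eigenvalue:
  assumes s: "spectral n A U d" and i: "i < n"
  obtains x where "x \<in> carrier_vec n" "x \<noteq> 0\<^sub>v n" "qform A x = complex_of_real (d i)"
proof
  have U: "unitary n U" using s by (simp add: spectral_def)
  let ?x = "U *\<^sub>v unit_vec n i"
  show x: "?x \<in> carrier_vec n" using unitaryD(1)[OF U] by auto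
  have Ux: "cadj U *\<^sub>v ?x = unit_vec n i"
    using unitaryD[OF U] by (subst assoc_mult_mat_vec[symmetric, of _ n n _ n]) auto
  show "?x \<noteq> 0\<^sub>v n"
  proof
    assume "?x = 0\<^sub>v n"
    hence "unit_vec n i = cadj U *\<^sub>v 0\<^sub>v n" using Ux by metis
    also have "\<dots> = 0\<^sub>v n" using unitaryD(1)[OF U] by (intro eq_vecI) (auto simp: mult_mat_vec_sum)
    finally have "unit_vec n i $ i = (0\<^sub>v n :: complex vec) $ i" by simp
    thus False using i by simp
  qed
  have "(\<Sum>k<n. d k * (cmod (unit_vec n i $ k))\<^sup>2) = (\<Sum>k<n. if k = i then d i else 0)"
    using i by (intro sum.cong) auto
  thus "qform A ?x = complex_of_real (d i)" unfolding qform_spectral[OF s x] Ux using i by simp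
qed

lemma spectral_psd: "spectral n A U d \<Longrightarrow> psd n A \<Longrightarrow> i < n \<Longrightarrow> 0 \<le> d i"
  by (metis Re_complex_of_real psdD(3) spectral_eigenvalue)

lemma spectral_pd: "spectral n A U d \<Longrightarrow> pd n A \<Longrightarrow> i < n \<Longrightarrow> 0 < d i"
  by (metis Re_complex_of_real pdD(4) spectral_eigenvalue)

lemma spectral_pos_pd:
  assumes s: "spectral n A U d" and d: "\<And>i. i < n \<Longrightarrow> 0 < d i"
  shows "pd n A"
proof (rule pdI)
  show "hermitian n A" using s by (rule spectral_hermitian)
  have U: "unitary n U" using s by (simp add: spectral_def)
  fix x :: "complex vec" assume x: "x \<in> carrier_vec n" "x \<noteq> 0\<^sub>v n"
  have "(\<Sum>i<n. (cmod ((cadj U *\<^sub>v x) $ i))\<^sup>2) > 0"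
    using unitary_norm[OF U x(1)] rqform_one_pos[OF x] by simp
  then obtain i where i: "i < n" "(cmod ((cadj U *\<^sub>v x) $ i))\<^sup>2 \<noteq> 0"
    by (metis (no_types, lifting) lessThan_iff less_irrefl sum.neutral)
  hence "(\<Sum>i<n. d i * (cmod ((cadj U *\<^sub>v x) $ i))\<^sup>2) > 0"
    using d by (intro sum_pos2[of _ i]) (auto simp: less_imp_le)
  thus "0 < rqform A x" by (simp only: qform_spectral[OF s x(1)] Re_complex_of_real)
qed

lemma pd_spectral:
  assumes "pd n A"
  obtains U d where "spectral n A U d" "\<And>i. i < n \<Longrightarrow> 0 < d i"
  using assms hermitian_spectral pdD(1) spectral_pd by metis

lemma pd_convex:
  assumes "pd n A" "pd n B" "0 \<le> l" "l \<le> 1"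
  shows "pd n (complex_of_real (1 - l) \<cdot>\<^sub>m A + complex_of_real l \<cdot>\<^sub>m B)"
proof (rule pdI)
  show "hermitian n (complex_of_real (1 - l) \<cdot>\<^sub>m A + complex_of_real l \<cdot>\<^sub>m B)"
    using assms by (intro hermitian_add hermitian_smult pdD)
  fix x :: "complex vec" assume x: "x \<in> carrier_vec n" "x \<noteq> 0\<^sub>v n"
  have "0 < (1 - l) * rqform A x + l * rqform B x"
  proof (cases "l = 0")
    case False
    thus ?thesis using pdD(4)[OF assms(1) x] pdD(4)[OF assms(2) x] assms
      by (intro add_nonneg_pos) auto
  qed (use pdD(4)[OF assms(1) x] in simp)
  thus "0 < rqform (complex_of_real (1 - l) \<cdot>\<^sub>m A + complex_of_real l \<cdot>\<^sub>m B) x"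
    using x pdD(2)[OF assms(1)] pdD(2)[OF assms(2)] by (simp add: qform_add[of _ n] qform_smult[of _ n])
qed

lemma pd_smult:
  assumes "pd n A" "0 < c"
  shows "pd n (complex_of_real c \<cdot>\<^sub>m A)"
proof (rule pdI)
  fix x :: "complex vec" assume x: "x \<in> carrier_vec n" "x \<noteq> 0\<^sub>v n"
  thus "0 < rqform (complex_of_real c \<cdot>\<^sub>m A) x"
    using pdD(4)[OF assms(1) x] pdD(2)[OF assms(1)] assms(2) by (simp add: qform_smult[of _ n])
qed (use assms in \<open>simp add: hermitian_smult pdD\<close>)

lemma pd_one: "pd n (1\<^sub>m n)"
  using spectral_pos_pd[OF spectral_rdiag[of n "\<lambda>_. 1"]] by simp

lemma spectral_scalar: "spectral n (complex_of_real c \<cdot>\<^sub>m 1\<^sub>m n) (1\<^sub>m n) (\<lambda>_. c)"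
proof -
  have "rdiag n (\<lambda>_. c) = complex_of_real c \<cdot>\<^sub>m 1\<^sub>m n" by (rule eq_matI) auto
  thus ?thesis using spectral_rdiag[of n "\<lambda>_. c"] by simp
qed

lemma mat_fun_scalar: "mat_fun f (complex_of_real c \<cdot>\<^sub>m 1\<^sub>m n) = complex_of_real (f c) \<cdot>\<^sub>m 1\<^sub>m n"
proof -
  have "rdiag n (\<lambda>_. f c) = complex_of_real (f c) \<cdot>\<^sub>m 1\<^sub>m n" by (rule eq_matI) auto
  thus ?thesis using mat_fun_spectral[OF spectral_scalar[of n c], of f]
    by (simp add: left_mult_one_mat[of _ n n] right_mult_one_mat[of _ n n])
qed

lemma mat_fun_conj:
  assumes "unitary n W" "spectral n B V e"
  shows "mat_fun f (W * B * cadj W) = W * mat_fun f B * cadj W"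
  using mat_fun_spectral[OF spectral_conj[OF assms], of f] mat_fun_spectral[OF assms(2), of f]
    unitary_dims[OF assms(1)] unitary_dims[of n V] assms(2)
  by (auto simp: spectral_def cadj_mult mult_mat_assoc)

lemma mat_fun_direct_sum:
  assumes A: "spectral n A U d" and B: "spectral m B V e"
  shows "mat_fun f (direct_sum A B) = direct_sum (mat_fun f A) (mat_fun f B)"
proof -
  have eq: "(\<lambda>i. complex_of_real (f (if i < n then d i else e (i - n))))
      = (\<lambda>i. complex_of_real (if i < n then f (d i) else f (e (i - n))))" by auto
  show ?thesis
    using spectral_direct_sum[OF spectral_mat_fun[OF A, of f] spectral_mat_fun[OF B, of f]]
    unfolding mat_fun_spectral[OF spectral_direct_sum[OF A B]] spectral_def by (simp add: eq)
qed

lemma qform_direct_sum: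
  assumes "A \<in> carrier_mat n n" "B \<in> carrier_mat m m" "x \<in> carrier_vec n" "y \<in> carrier_vec m"
  shows "qform (direct_sum A B) (x @\<^sub>v y) = qform A x + qform B y"
proof -
  have "direct_sum A B *\<^sub>v (x @\<^sub>v y) = (A *\<^sub>v x) @\<^sub>v (B *\<^sub>v y)"
  proof -
    have "0\<^sub>m n m *\<^sub>v y = 0\<^sub>v n" "0\<^sub>m m n *\<^sub>v x = 0\<^sub>v m"
      using assms by (auto intro!: eq_vecI simp: mult_mat_vec_sum)
    thus ?thesis
      unfolding direct_sum_def using assms
      by (subst four_block_mat_mult_vec[of _ n n _ m _ m]) auto
  qed
  moreover have split: "(\<Sum>i<n+m. h i) = (\<Sum>i<n. h i) + (\<Sum>i<m. h (n + i))" for h :: "nat \<Rightarrow> complex"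
    by (induction m) (auto simp: add.assoc)
  ultimately have "qform (direct_sum A B) (x @\<^sub>v y)
      = (\<Sum>i<n+m. cnj ((x @\<^sub>v y) $ i) * ((A *\<^sub>v x) @\<^sub>v (B *\<^sub>v y)) $ i)"
    using assms by (simp add: qform_def)
  also have "\<dots> = (\<Sum>i<n. cnj ((x @\<^sub>v y) $ i) * ((A *\<^sub>v x) @\<^sub>v (B *\<^sub>v y)) $ i)
      + (\<Sum>i<m. cnj ((x @\<^sub>v y) $ (n+i)) * ((A *\<^sub>v x) @\<^sub>v (B *\<^sub>v y)) $ (n+i))"
    by (rule split)
  also have "\<dots> = qform A x + qform B y" using assms by (simp add: qform_def)
  finally show ?thesis .
qed

text \<open>In an eigenbasis this is the scalar estimate of |z + w|^2 by weighted squares, whose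
  cross term is controlled by the square of
  \<open>sqrt \<delta> * cmod z - cmod w / sqrt \<delta>\<close>. It makes one summand almost free
  and charges everything to the other, which is how off-diagonal blocks are removed later.\<close>

lemma qform_sum_bound:
  assumes "psd n A" "u \<in> carrier_vec n" "v \<in> carrier_vec n" "0 < (\<delta>::real)"
  shows "rqform A (u + v) \<le> (1 + \<delta>) * rqform A u + (1 + 1 / \<delta>) * rqform A v"
proof -
  obtain U d where s: "spectral n A U d" using assms(1) psdD(1) hermitian_spectral by metis
  have c: "cadj U \<in> carrier_mat n n" using s unitaryD(1) by (auto simp: spectral_def)
  have k: "(cmod (z + w))\<^sup>2 \<le> (1 + \<delta>) * (cmod z)\<^sup>2 + (1 + 1 / \<delta>) * (cmod w)\<^sup>2" for z w
  proof -
    have "(cmod (z + w))\<^sup>2 \<le> (cmod z + cmod w)\<^sup>2" by (intro power_mono norm_triangle_ineq) auto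
    moreover have "0 \<le> (sqrt \<delta> * cmod z - cmod w / sqrt \<delta>)\<^sup>2" by simp
    hence "2 * cmod z * cmod w \<le> \<delta> * (cmod z)\<^sup>2 + (cmod w)\<^sup>2 / \<delta>"
      using assms(4) by (simp add: power2_diff power_mult_distrib power_divide mult.assoc)
    ultimately show ?thesis by (simp add: power2_sum algebra_simps)
  qed
  have "rqform A (u + v) = (\<Sum>i<n. d i * (cmod ((cadj U *\<^sub>v u) $ i + (cadj U *\<^sub>v v) $ i))\<^sup>2)"
    using assms c
    by (auto simp: qform_spectral[OF s] mult_add_distrib_mat_vec[OF c] simp del: of_real_sum intro!: sum.cong)
  also have "\<dots> \<le> (\<Sum>i<n. d i * ((1 + \<delta>) * (cmod ((cadj U *\<^sub>v u) $ i))\<^sup>2 + (1 + 1 / \<delta>) * (cmod ((cadj U *\<^sub>v v) $ i))\<^sup>2))"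
    using spectral_psd[OF s assms(1)] k by (intro sum_mono mult_left_mono) auto
  also have "\<dots> = (1 + \<delta>) * rqform A u + (1 + 1 / \<delta>) * rqform A v"
    unfolding qform_spectral[OF s assms(2)] qform_spectral[OF s assms(3)] Re_complex_of_real
    by (simp only: sum_distrib_left sum.distrib[symmetric] distrib_left mult_ac)
  finally show ?thesis .
qed

lemma psd_le_scalar:
  assumes "psd n A"
  obtains \<mu> where "0 < \<mu>" "\<And>x. x \<in> carrier_vec n \<Longrightarrow> rqform A x \<le> \<mu> * rqform (1\<^sub>m n) x"
proof -
  obtain U d where s: "spectral n A U d" using assms psdD(1) hermitian_spectral by metis
  have U: "unitary n U" using s by (simp add: spectral_def)
  \<comment> \<open>The sum of absolute values dominates every eigenvalue without a maximum over a
    possibly empty index set; the 1 makes the bound positive.\<close>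
  define \<mu> where "\<mu> = 1 + (\<Sum>i<n. \<bar>d i\<bar>)"
  have "d i \<le> \<mu>" if "i < n" for i
    using member_le_sum[of i "{..<n}" "\<lambda>i. \<bar>d i\<bar>"] that by (auto simp: \<mu>_def)
  hence "rqform A x \<le> \<mu> * rqform (1\<^sub>m n) x" if "x \<in> carrier_vec n" for x
    unfolding qform_spectral[OF s that] unitary_norm[OF U that, symmetric] Re_complex_of_real sum_distrib_left
    by (intro sum_mono mult_right_mono) auto
  moreover have "0 < \<mu>" unfolding \<mu>_def by (intro add_pos_nonneg sum_nonneg) auto
  ultimately show ?thesis using that by blast
qed

section \<open>Operator monotone functions are operator concave\<close>

text \<open>The plane rotation with cosine \<open>a\<close> and sine \<open>b\<close>, acting on two
  copies of the space. It sends (x, 0) to (a x, b x), so a block sum tested there weights its two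
  blocks by a^2 and b^2.\<close>

definition rotation :: "nat \<Rightarrow> real \<Rightarrow> real \<Rightarrow> complex mat" where
  "rotation n a b = four_block_mat (complex_of_real a \<cdot>\<^sub>m 1\<^sub>m n) (complex_of_real (- b) \<cdot>\<^sub>m 1\<^sub>m n)
     (complex_of_real b \<cdot>\<^sub>m 1\<^sub>m n) (complex_of_real a \<cdot>\<^sub>m 1\<^sub>m n)"

lemma rotation_carrier[simp]: "rotation n a b \<in> carrier_mat (n + n) (n + n)"
  by (auto simp: rotation_def)

lemma smult_one_mult:
  "(c \<cdot>\<^sub>m 1\<^sub>m n) * (d \<cdot>\<^sub>m 1\<^sub>m n) = (c * d :: complex) \<cdot>\<^sub>m 1\<^sub>m n"
proof -
  have "e \<cdot>\<^sub>m 1\<^sub>m n = mat_diag n (\<lambda>_. e)" for e :: complex by (rule eq_matI) auto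
  thus ?thesis by simp
qed

lemma smult_one_add:
  "c \<cdot>\<^sub>m 1\<^sub>m n + d \<cdot>\<^sub>m 1\<^sub>m n = (c + d :: complex) \<cdot>\<^sub>m 1\<^sub>m n"
  by (rule eq_matI) auto

lemma unitary_rotation:
  assumes "a\<^sup>2 + b\<^sup>2 = 1"
  shows "unitary (n + n) (rotation n a b)"
proof -
  have "cadj (rotation n a b) = four_block_mat (complex_of_real a \<cdot>\<^sub>m 1\<^sub>m n) (complex_of_real b \<cdot>\<^sub>m 1\<^sub>m n)
     (complex_of_real (- b) \<cdot>\<^sub>m 1\<^sub>m n) (complex_of_real a \<cdot>\<^sub>m 1\<^sub>m n)"
    by (rule eq_matI) (auto simp: rotation_def)
  hence "cadj (rotation n a b) * rotation n a b = four_block_mat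
      (complex_of_real (a * a + b * b) \<cdot>\<^sub>m 1\<^sub>m n) (complex_of_real (a * (-b) + b * a) \<cdot>\<^sub>m 1\<^sub>m n)
      (complex_of_real ((- b) * a + a * b) \<cdot>\<^sub>m 1\<^sub>m n) (complex_of_real ((-b) * (-b) + a * a) \<cdot>\<^sub>m 1\<^sub>m n)"
    unfolding rotation_def of_real_add of_real_mult
    by (simp only: mult_four_block_mat[of _ n n _ n _ n _ _ n _ n] smult_carrier_mat one_carrier_mat
        smult_one_mult smult_one_add)
  also have "\<dots> = direct_sum (1\<^sub>m n) (1\<^sub>m n)"
    using assms by (simp add: direct_sum_def power2_eq_square add.commute)
       (rule eq_matI, auto)
  finally show ?thesis by (simp add: unitary_def direct_sum_one)
qed

lemma smult_one_mult_vec: "x \<in> carrier_vec n \<Longrightarrow> (c \<cdot>\<^sub>m 1\<^sub>m n) *\<^sub>v x = (c::complex) \<cdot>\<^sub>v x"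
proof (rule eq_vecI)
  assume x: "x \<in> carrier_vec n"
  fix i assume "i < dim_vec (c \<cdot>\<^sub>v x)"
  hence i: "i < n" using x by simp
  have "(\<Sum>k<n. (c \<cdot>\<^sub>m 1\<^sub>m n) $$ (i,k) * x $ k) = (\<Sum>k<n. if k = i then c * x $ i else 0)"
    using i by (intro sum.cong) auto
  thus "((c \<cdot>\<^sub>m 1\<^sub>m n) *\<^sub>v x) $ i = (c \<cdot>\<^sub>v x) $ i"
    using x i by (simp add: mult_mat_vec_sum)
qed simp

lemma rotation_mult_vec:
  assumes "x \<in> carrier_vec n" "y \<in> carrier_vec n"
  shows "rotation n a b *\<^sub>v (x @\<^sub>v y)
    = (complex_of_real a \<cdot>\<^sub>v x + complex_of_real (- b) \<cdot>\<^sub>v y) @\<^sub>v (complex_of_real b \<cdot>\<^sub>v x + complex_of_real a \<cdot>\<^sub>v y)"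
  unfolding rotation_def using assms
  by (subst four_block_mat_mult_vec[of _ n n _ n _ n]) (auto simp: smult_one_mult_vec simp del: of_real_minus)

text \<open>The 2-by-2 block trick: rotating the direct sum of A and B puts the convex combination in the
  corner, and the off-diagonal blocks are absorbed by the factor 1 + \<delta> and a large scalar block.\<close>
lemma operator_monotone_block:
  assumes f: "operator_monotone_pos f" and A: "pd n A" and B: "pd n B"
    and l: "0 \<le> l" "l \<le> 1" and \<delta>: "0 < \<delta>" and x: "x \<in> carrier_vec n"
  shows "(1 - l) * rqform (mat_fun f A) x + l * rqform (mat_fun f B) x
    \<le> rqform (mat_fun f (complex_of_real (1 + \<delta>) \<cdot>\<^sub>m (complex_of_real (1 - l) \<cdot>\<^sub>m A + complex_of_real l \<cdot>\<^sub>m B))) x"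
proof -
  define a b where "a = sqrt (1 - l)" and "b = sqrt l"
  have ab: "a\<^sup>2 = 1 - l" "b\<^sup>2 = l" using l by (auto simp: a_def b_def)
  obtain U d where sA: "spectral n A U d" "\<And>i. i < n \<Longrightarrow> 0 < d i" using pd_spectral[OF A] by blast
  obtain V e where sB: "spectral n B V e" "\<And>i. i < n \<Longrightarrow> 0 < e i" using pd_spectral[OF B] by blast
  define Al where "Al = complex_of_real (1 - l) \<cdot>\<^sub>m A + complex_of_real l \<cdot>\<^sub>m B"
  have Al: "pd n Al" unfolding Al_def by (rule pd_convex[OF A B l])
  have c: "A \<in> carrier_mat n n" "B \<in> carrier_mat n n" "Al \<in> carrier_mat n n"
    using A B Al by (auto dest: pdD(2))
  define E where "E = complex_of_real (1 + \<delta>) \<cdot>\<^sub>m Al"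
  have E: "pd n E" unfolding E_def using \<delta> by (intro pd_smult[OF Al]) auto
  obtain UE dE where sE: "spectral n E UE dE" "\<And>i. i < n \<Longrightarrow> 0 < dE i" using pd_spectral[OF E] by blast
  obtain \<mu>A where \<mu>A: "0 < \<mu>A" "\<And>x. x \<in> carrier_vec n \<Longrightarrow> rqform A x \<le> \<mu>A * rqform (1\<^sub>m n) x"
    using psd_le_scalar[OF pdD(3)[OF A]] by blast
  obtain \<mu>B where \<mu>B: "0 < \<mu>B" "\<And>x. x \<in> carrier_vec n \<Longrightarrow> rqform B x \<le> \<mu>B * rqform (1\<^sub>m n) x"
    using psd_le_scalar[OF pdD(3)[OF B]] by blast
  \<comment> \<open>The cost of the second component \<open>v\<close>: the weight 1 + 1 / \<delta>
    from \<open>qform_sum_bound\<close>, with the coefficients \<open>l\<close> and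
    \<open>1 - l\<close> estimated by 1.\<close>
  define \<mu> where "\<mu> = (1 + 1 / \<delta>) * (\<mu>A + \<mu>B)"
  have \<mu>: "0 < \<mu>" using \<delta> \<mu>A(1) \<mu>B(1) by (auto simp: \<mu>_def intro!: mult_pos_pos add_pos_pos)
  define G where "G = complex_of_real \<mu> \<cdot>\<^sub>m 1\<^sub>m n"
  have sG: "spectral n G (1\<^sub>m n) (\<lambda>_. \<mu>)" unfolding G_def by (rule spectral_scalar)
  define W where "W = rotation n a b"
  have W: "unitary (n + n) W" unfolding W_def by (rule unitary_rotation) (simp add: ab)
  note Wc = unitaryD(1)[OF W]
  define C where "C = cadj W * direct_sum A B * W"
  have sAB: "spectral (n + n) (direct_sum A B) (direct_sum U V) (\<lambda>i. if i < n then d i else e (i - n))"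
    by (rule spectral_direct_sum[OF sA(1) sB(1)])
  have sC: "spectral (n + n) C (cadj W * direct_sum U V) (\<lambda>i. if i < n then d i else e (i - n))"
    using spectral_conj[OF unitary_cadj[OF W] sAB] by (simp add: C_def)
  have fC: "mat_fun f C = cadj W * direct_sum (mat_fun f A) (mat_fun f B) * W"
    using mat_fun_conj[OF unitary_cadj[OF W] sAB, of f] mat_fun_direct_sum[OF sA(1) sB(1), of f]
    by (simp add: C_def)
  have sD: "spectral (n + n) (direct_sum E G) (direct_sum UE (1\<^sub>m n)) (\<lambda>i. if i < n then dE i else \<mu>)"
    using spectral_direct_sum[OF sE(1) sG] by simp
  have fD: "mat_fun f (direct_sum E G) = direct_sum (mat_fun f E) (mat_fun f G)"
    by (rule mat_fun_direct_sum[OF sE(1) sG])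
  have cC: "C \<in> carrier_mat (n + n) (n + n)" by (rule spectral_carrier[OF sC])
  have cD: "direct_sum E G \<in> carrier_mat (n + n) (n + n)" by (rule spectral_carrier[OF sD])
  have cE: "E \<in> carrier_mat n n" "G \<in> carrier_mat n n" using spectral_carrier sE(1) sG by blast+
  have cf: "mat_fun f A \<in> carrier_mat n n" "mat_fun f B \<in> carrier_mat n n" 
    "mat_fun f E \<in> carrier_mat n n" "mat_fun f G \<in> carrier_mat n n"
    using spectral_carrier spectral_mat_fun sA(1) sB(1) sE(1) sG by blast+
  have cf': "mat_fun f C \<in> carrier_mat (n + n) (n + n)" "mat_fun f (direct_sum E G) \<in> carrier_mat (n + n) (n + n)"
    using spectral_carrier spectral_mat_fun sC sD by blast+
  have pC: "pd (n + n) C" by (rule spectral_pos_pd[OF sC]) (use sA sB in auto)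
  have pD: "pd (n + n) (direct_sum E G)" by (rule spectral_pos_pd[OF sD]) (use sE \<mu> in auto)
  have le: "psd (n + n) (direct_sum E G - C)"
  proof (rule psdI)
    show "hermitian (n + n) (direct_sum E G - C)"
      by (rule hermitian_minus[OF pdD(1)[OF pD] pdD(1)[OF pC]])
    fix z :: "complex vec" assume z: "z \<in> carrier_vec (n + n)"
    obtain u v where uv: "u \<in> carrier_vec n" "v \<in> carrier_vec n" "z = u @\<^sub>v v"
      using z vec_first_last_append[OF z] by (metis vec_first_carrier vec_last_carrier)
    have bound: "rqform M (complex_of_real s \<cdot>\<^sub>v u + complex_of_real t \<cdot>\<^sub>v v)
        \<le> (1 + \<delta>) * s\<^sup>2 * rqform M u + (1 + 1 / \<delta>) * t\<^sup>2 * rqform M v" if "pd n M" for M s t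
    proof -
      have "rqform M (complex_of_real s \<cdot>\<^sub>v u + complex_of_real t \<cdot>\<^sub>v v)
        \<le> (1 + \<delta>) * rqform M (complex_of_real s \<cdot>\<^sub>v u) + (1 + 1 / \<delta>) * rqform M (complex_of_real t \<cdot>\<^sub>v v)"
        using uv by (intro qform_sum_bound[OF pdD(3)[OF that]] \<delta>) auto
      thus ?thesis using uv pdD(2)[OF that] 
        by (simp add: qform_smult_vec[of _ n] mult.assoc del: of_real_power)
    qed
    have "qform C z = qform (direct_sum A B) (W *\<^sub>v z)"
      unfolding C_def by (rule qform_conj[OF Wc _ z]) (use spectral_carrier[OF sAB] in simp)
    hence "qform C z = qform A (complex_of_real a \<cdot>\<^sub>v u + complex_of_real (- b) \<cdot>\<^sub>v v)
        + qform B (complex_of_real b \<cdot>\<^sub>v u + complex_of_real a \<cdot>\<^sub>v v)"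
      unfolding W_def uv(3) rotation_mult_vec[OF uv(1,2)] using uv c
      by (subst (asm) qform_direct_sum[of _ n _ n]) auto
    hence "rqform C z \<le> ((1 + \<delta>) * a\<^sup>2 * rqform A u + (1 + 1 / \<delta>) * (-b)\<^sup>2 * rqform A v)
        + ((1 + \<delta>) * b\<^sup>2 * rqform B u + (1 + 1 / \<delta>) * a\<^sup>2 * rqform B v)"
      using bound[OF A, of a "-b"] bound[OF B, of b a] by simp
    also have "\<dots> = (1 + \<delta>) * ((1 - l) * rqform A u + l * rqform B u)
        + (1 + 1 / \<delta>) * (l * rqform A v + (1 - l) * rqform B v)"
      by (simp add: ab diff_divide_distrib algebra_simps)
    also have "\<dots> \<le> (1 + \<delta>) * ((1 - l) * rqform A u + l * rqform B u)
        + (1 + 1 / \<delta>) * ((\<mu>A + \<mu>B) * rqform (1\<^sub>m n) v)"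
    proof -
      have "l * rqform A v \<le> 1 * rqform A v" "(1 - l) * rqform B v \<le> 1 * rqform B v"
        using l psdD(3)[OF pdD(3)[OF A] uv(2)] psdD(3)[OF pdD(3)[OF B] uv(2)]
        by (intro mult_right_mono; simp)+
      hence "l * rqform A v + (1 - l) * rqform B v \<le> (\<mu>A + \<mu>B) * rqform (1\<^sub>m n) v"
        using \<mu>A(2)[OF uv(2)] \<mu>B(2)[OF uv(2)] by (simp add: distrib_right)
      thus ?thesis using \<delta> by (intro add_left_mono mult_left_mono) auto
    qed
    also have "\<dots> = rqform (direct_sum E G) z"
      unfolding uv(3) using uv c cE
      by (subst qform_direct_sum[of _ n _ n])
         (auto simp: E_def G_def Al_def qform_smult[of _ n] qform_add[of _ n] \<mu>_def)
    finally show "0 \<le> rqform (direct_sum E G - C) z"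
      using z cC cD by (simp add: qform_minus[of _ "n + n"])
  qed
  hence "psd (n + n) (mat_fun f (direct_sum E G) - mat_fun f C)"
    using f pC pD cC cD unfolding operator_monotone_pos_def loewner_le_def by blast
  \<comment> \<open>The zero second component discards the block \<open>mat_fun f G\<close>. Hence
    \<mu>, which blows up as \<delta> tends to 0, leaves no trace in the conclusion.\<close>
  moreover define z where "z = x @\<^sub>v 0\<^sub>v n"
  moreover have z: "z \<in> carrier_vec (n + n)" using x by (simp add: z_def)
  ultimately have "rqform (mat_fun f C) z \<le> rqform (mat_fun f (direct_sum E G)) z"
    using psdD(3)[OF _ z, of "mat_fun f (direct_sum E G) - mat_fun f C"] cf' by (simp add: qform_minus[of _ "n + n"])
  also have "qform (mat_fun f (direct_sum E G)) z = qform (mat_fun f E) x"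
    unfolding fD z_def using x cf by (subst qform_direct_sum[of _ n _ n]) (auto simp: qform_zero_vec)
  also have "qform (mat_fun f C) z = qform (direct_sum (mat_fun f A) (mat_fun f B)) (W *\<^sub>v z)"
    unfolding fC by (rule qform_conj[OF Wc direct_sum_carrier[OF cf(1,2)] z])
  also have "W *\<^sub>v z = (complex_of_real a \<cdot>\<^sub>v x) @\<^sub>v (complex_of_real b \<cdot>\<^sub>v x)"
    unfolding W_def z_def using x by (subst rotation_mult_vec) auto
  also have "qform (direct_sum (mat_fun f A) (mat_fun f B)) \<dots>
      = complex_of_real (a\<^sup>2) * qform (mat_fun f A) x + complex_of_real (b\<^sup>2) * qform (mat_fun f B) x"
    using x cf by (subst qform_direct_sum[of _ n _ n]) (auto simp: qform_smult_vec[of _ n] simp del: of_real_power)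
  finally show ?thesis by (simp add: ab E_def Al_def del: of_real_power)
qed

section \<open>From the block inequality to operator concavity\<close>

lemma pd_scalar: "0 < c \<Longrightarrow> pd n (complex_of_real c \<cdot>\<^sub>m 1\<^sub>m n)"
  by (rule pd_smult[OF pd_one])

lemma rqform_scalar_unit: "rqform (complex_of_real c \<cdot>\<^sub>m 1\<^sub>m 1) (unit_vec 1 0) = c"
  by (simp add: qform_smult[of _ 1] qform_one)

lemma operator_monotone_mono:
  assumes "operator_monotone_pos f" "0 < s" "s \<le> t"
  shows "f s \<le> f t"
proof -
  have eq: "complex_of_real t \<cdot>\<^sub>m 1\<^sub>m 1 - complex_of_real s \<cdot>\<^sub>m 1\<^sub>m 1 = complex_of_real (t - s) \<cdot>\<^sub>m 1\<^sub>m 1" for s t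
    by (rule eq_matI) auto
  have "psd 1 (complex_of_real t \<cdot>\<^sub>m 1\<^sub>m 1 - complex_of_real s \<cdot>\<^sub>m 1\<^sub>m 1)"
    unfolding eq by (rule spectral_nonneg_psd[OF spectral_scalar]) (use assms in simp)
  hence "psd 1 (mat_fun f (complex_of_real t \<cdot>\<^sub>m 1\<^sub>m 1) - mat_fun f (complex_of_real s \<cdot>\<^sub>m 1\<^sub>m 1))"
    using assms pd_scalar[of s 1] pd_scalar[of t 1] unfolding operator_monotone_pos_def loewner_le_def by auto
  hence "psd 1 (complex_of_real (f t - f s) \<cdot>\<^sub>m 1\<^sub>m 1)" unfolding mat_fun_scalar eq .
  from psdD(3)[OF this, of "unit_vec 1 0"] rqform_scalar_unit[of "f t - f s"] show ?thesis by simp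
qed

text \<open>The block inequality is read for positive numbers \<open>a\<close> and \<open>b\<close>,
  with weight \<open>l\<close> on \<open>b = (1 + \<delta>) * t\<close>. When the enlarged convex
  combination equals \<open>t\<close>, dropping the nonnegative term at \<open>a\<close> leaves l *
  f b \<le> f t. Of the three factors in the exponent, one pays for the enlargement in the block
  inequality, one for \<open>b / t\<close>, and the third leaves room for a positive
  \<open>a\<close>.\<close>

lemma operator_monotone_growth:
  assumes f: "operator_monotone_pos f" "\<And>t. 0 < t \<Longrightarrow> 0 \<le> f t" and t: "0 < t" and \<delta>: "0 < \<delta>"
  shows "f ((1 + \<delta>) * t) \<le> (1 + \<delta>) ^ 3 * f t"
proof -
  define b where "b = (1 + \<delta>) * t"
  define l where "l = 1 / (1 + \<delta>) ^ 3"
  have l: "0 < l" "l < 1" using \<delta> by (auto simp: l_def intro!: power_gt1)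
  \<comment> \<open>The solution of \<open>(1 + \<delta>) * ((1 - l) * a + l * b) = t\<close>; here
    \<open>(1 + \<delta>) * (l * b)\<close> is \<open>t / (1 + \<delta>)\<close>, so
    \<open>a\<close> comes out positive.\<close>
  define a where "a = \<delta> * l * b / (1 - l)"
  have b: "0 < b" using t \<delta> by (simp add: b_def)
  have a: "0 < a" using l \<delta> b by (simp add: a_def)
  have "(1 - l) * a = \<delta> * l * b" using l by (simp add: a_def)
  hence "(1 - l) * a + l * b = (1 + \<delta>) * (l * b)" by (simp add: algebra_simps)
  hence "(1 + \<delta>) * ((1 - l) * a + l * b) = (1 + \<delta>) ^ 3 * l * t"
    by (simp only: b_def power3_eq_cube mult_ac)
  also have "\<dots> = t" using \<delta> by (simp add: l_def)
  finally have eq: "(1 + \<delta>) * ((1 - l) * a + l * b) = t" .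
  have smult: "complex_of_real (1 + \<delta>) \<cdot>\<^sub>m (complex_of_real (1 - l) \<cdot>\<^sub>m (complex_of_real a \<cdot>\<^sub>m 1\<^sub>m 1)
      + complex_of_real l \<cdot>\<^sub>m (complex_of_real b \<cdot>\<^sub>m 1\<^sub>m 1)) = complex_of_real t \<cdot>\<^sub>m 1\<^sub>m 1"
    unfolding eq[symmetric] by (rule eq_matI) (auto simp: algebra_simps)
  have "(1 - l) * f a + l * f b \<le> f t"
    using operator_monotone_block[OF f(1) pd_scalar[OF a, of 1] pd_scalar[OF b, of 1] less_imp_le[OF l(1)]
        less_imp_le[OF l(2)] \<delta>, of "unit_vec 1 0"]
    unfolding smult mat_fun_scalar rqform_scalar_unit by simp
  moreover have "0 \<le> (1 - l) * f a" using l f(2)[OF a] by simp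
  ultimately have "l * f b \<le> f t" by linarith
  thus ?thesis using \<delta> by (simp add: l_def b_def field_simps)
qed

text \<open>If f t = 0 < f s, monotonicity forces t < s, and then the growth bound with ratio
  \<open>s / t\<close> gives f s \<le> (s / t)^3 * f t = 0.\<close>

lemma operator_monotone_zero_or_pos:
  assumes f: "operator_monotone_pos f" "\<And>t. 0 < t \<Longrightarrow> 0 \<le> f t"
  shows "(\<forall>t>0. f t = 0) \<or> (\<forall>t>0. 0 < f t)"
proof (rule ccontr)
  assume "\<not> ?thesis"
  then obtain s t where st: "0 < s" "f s \<noteq> 0" "0 < t" "\<not> 0 < f t" by blast
  hence "f t = 0" "0 < f s" using f(2)[of t] f(2)[of s] by auto
  moreover have "t < s" using operator_monotone_mono[OF f(1) st(1), of t] calculation by fastforce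
  ultimately show False
    using operator_monotone_growth[OF f st(3), of "s / t - 1"] st by simp
qed

text \<open>Multiplying by 1 + \<delta> keeps the eigenbasis, so the scalar growth bound applies
  eigenvalue by eigenvalue and pulls (1 + \<delta>)^3 out of the quadratic form. The limit \<delta>
  \<rightarrow> 0 is then that of a polynomial.\<close>

theorem operator_monotone_concave:
  assumes f: "operator_monotone_pos f" "\<And>t. 0 < t \<Longrightarrow> 0 \<le> f t" and A: "pd n A" and B: "pd n B"
    and l: "0 \<le> l" "l \<le> 1"
  shows "psd n (mat_fun f (complex_of_real (1 - l) \<cdot>\<^sub>m A + complex_of_real l \<cdot>\<^sub>m B)
    - (complex_of_real (1 - l) \<cdot>\<^sub>m mat_fun f A + complex_of_real l \<cdot>\<^sub>m mat_fun f B))"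
proof -
  define C where "C = complex_of_real (1 - l) \<cdot>\<^sub>m A + complex_of_real l \<cdot>\<^sub>m B"
  have C: "pd n C" unfolding C_def by (rule pd_convex[OF A B l])
  have h: "hermitian n (mat_fun f M)" if "pd n M" for M
    using pd_spectral[OF that] spectral_mat_fun spectral_hermitian by metis
  have c: "mat_fun f M \<in> carrier_mat n n" if "pd n M" for M
    using h[OF that] by (simp add: hermitian_def)
  obtain U d where s: "spectral n C U d" "\<And>i. i < n \<Longrightarrow> 0 < d i" using pd_spectral[OF C] by blast
  show ?thesis
    unfolding C_def[symmetric]
  proof (rule psdI)
    fix x :: "complex vec" assume x: "x \<in> carrier_vec n"
    let ?q = "(1 - l) * rqform (mat_fun f A) x + l * rqform (mat_fun f B) x"
    have "?q \<le> (1 + \<delta>) ^ 3 * rqform (mat_fun f C) x" if \<delta>: "0 < \<delta>" for \<delta> :: real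
    proof -
      have "?q \<le> rqform (mat_fun f (complex_of_real (1 + \<delta>) \<cdot>\<^sub>m C)) x"
        unfolding C_def by (rule operator_monotone_block[OF f(1) A B l \<delta> x])
      also have "complex_of_real (1 + \<delta>) \<cdot>\<^sub>m C = U * rdiag n (\<lambda>i. (1 + \<delta>) * d i) * cadj U"
      proof -
        have U: "U \<in> carrier_mat n n" "C = U * rdiag n d * cadj U"
          using s(1) by (auto simp: spectral_def unitary_def)
        have "rdiag n (\<lambda>i. (1 + \<delta>) * d i) = complex_of_real (1 + \<delta>) \<cdot>\<^sub>m rdiag n d" by (rule eq_matI) auto
        moreover have "complex_of_real (1 + \<delta>) \<cdot>\<^sub>m (U * rdiag n d * cadj U)
            = U * (complex_of_real (1 + \<delta>) \<cdot>\<^sub>m rdiag n d) * cadj U"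
          using mult_smult_distrib[OF U(1) mat_diag_dim] 
            mult_smult_assoc_mat[OF mult_carrier_mat[OF U(1) mat_diag_dim] cadj_carrier[OF U(1)]] by simp
        ultimately show ?thesis using U(2) by simp
      qed
      also have "rqform (mat_fun f \<dots>) x = (\<Sum>i<n. f ((1 + \<delta>) * d i) * (cmod ((cadj U *\<^sub>v x) $ i))\<^sup>2)"
      proof -
        have "spectral n (U * rdiag n (\<lambda>i. (1 + \<delta>) * d i) * cadj U) U (\<lambda>i. (1 + \<delta>) * d i)"
          using s(1) by (simp add: spectral_def)
        from qform_spectral[OF spectral_mat_fun[OF this, of f] x] show ?thesis by simp
      qed
      also have "\<dots> \<le> (\<Sum>i<n. ((1 + \<delta>) ^ 3 * f (d i)) * (cmod ((cadj U *\<^sub>v x) $ i))\<^sup>2)"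
        using operator_monotone_growth[OF f s(2) \<delta>] by (intro sum_mono mult_right_mono) auto
      also have "\<dots> = (1 + \<delta>) ^ 3 * rqform (mat_fun f C) x"
        unfolding qform_spectral[OF spectral_mat_fun[OF s(1)] x] Re_complex_of_real sum_distrib_left
        by (simp add: mult.assoc)
      finally show ?thesis .
    qed
    hence ev: "\<forall>\<^sub>F \<delta> in at_right 0. ?q \<le> (1 + \<delta>) ^ 3 * rqform (mat_fun f C) x"
      by (auto simp: eventually_at_right_field intro: exI[of _ 1])
    have "((\<lambda>\<delta>::real. (1 + \<delta>) ^ 3 * rqform (mat_fun f C) x) \<longlongrightarrow> (1 + 0) ^ 3 * rqform (mat_fun f C) x) (at_right 0)"
      by (intro tendsto_intros)
    from tendsto_lowerbound[OF this ev] have "?q \<le> rqform (mat_fun f C) x" by simp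
    thus "0 \<le> rqform (mat_fun f C - (complex_of_real (1 - l) \<cdot>\<^sub>m mat_fun f A + complex_of_real l \<cdot>\<^sub>m mat_fun f B)) x"
      using c[OF A] c[OF B] c[OF C] x by (simp add: qform_minus[of _ n] qform_add[of _ n] qform_smult[of _ n])
  qed (intro hermitian_minus hermitian_add hermitian_smult h A B C)
qed

section \<open>Unital positive linear maps\<close>

lemma linear_mat_mapD:
  assumes "linear_mat_map k n \<Phi>"
  shows "A \<in> carrier_mat k k \<Longrightarrow> \<Phi> A \<in> carrier_mat n n"
    "A \<in> carrier_mat k k \<Longrightarrow> B \<in> carrier_mat k k \<Longrightarrow> \<Phi> (A + B) = \<Phi> A + \<Phi> B"
    "A \<in> carrier_mat k k \<Longrightarrow> \<Phi> (c \<cdot>\<^sub>m A) = c \<cdot>\<^sub>m \<Phi> A"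
    "A \<in> carrier_mat k k \<Longrightarrow> B \<in> carrier_mat k k \<Longrightarrow> \<Phi> (A - B) = \<Phi> A - \<Phi> B"
proof -
  show *: "A \<in> carrier_mat k k \<Longrightarrow> \<Phi> A \<in> carrier_mat n n"
    "A \<in> carrier_mat k k \<Longrightarrow> B \<in> carrier_mat k k \<Longrightarrow> \<Phi> (A + B) = \<Phi> A + \<Phi> B"
    "A \<in> carrier_mat k k \<Longrightarrow> \<Phi> (c \<cdot>\<^sub>m A) = c \<cdot>\<^sub>m \<Phi> A" for A B c
    using assms by (auto simp: linear_mat_map_def)
  assume c: "A \<in> carrier_mat k k" "B \<in> carrier_mat k k"
  have "A - B = A + (-1) \<cdot>\<^sub>m B" by (rule eq_matI) (use c in auto)
  hence "\<Phi> (A - B) = \<Phi> A + (-1) \<cdot>\<^sub>m \<Phi> B" using * c by simp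
  also have "\<dots> = \<Phi> A - \<Phi> B" by (rule eq_matI) (use *(1)[OF c(1)] *(1)[OF c(2)] in auto)
  finally show "\<Phi> (A - B) = \<Phi> A - \<Phi> B" .
qed

text \<open>A positive definite \<open>P\<close> dominates a positive multiple \<open>c\<close> of
  the identity. Positivity and unitality carry this bound over to the image with the same
  \<open>c\<close>.\<close>

lemma unital_positive_pd:
  assumes \<Phi>: "linear_mat_map k n \<Phi>" "positive_map k n \<Phi>" "unital_map k n \<Phi>" and P: "pd k P"
  shows "pd n (\<Phi> P)"
proof (rule pdI)
  have "psd n (\<Phi> P)" using \<Phi>(2) pdD(3)[OF P] by (simp add: positive_map_def)
  thus h: "hermitian n (\<Phi> P)" by (rule psdD(1))
  obtain U d where s: "spectral k P U d" "\<And>i. i < k \<Longrightarrow> 0 < d i" using pd_spectral[OF P] by blast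
  \<comment> \<open>The inserted 1 keeps the minimum meaningful for \<open>k = 0\<close> and is
    harmless otherwise, since any positive lower bound of the eigenvalues will do.\<close>
  define c where "c = Min (insert 1 (d ` {..<k}))"
  have c: "0 < c" "\<And>i. i < k \<Longrightarrow> c \<le> d i" using s(2) by (auto simp: c_def)
  have U: "unitary k U" using s(1) by (simp add: spectral_def)
  have Pc: "P \<in> carrier_mat k k" using P by (rule pdD(2))
  have "psd k (P - complex_of_real c \<cdot>\<^sub>m 1\<^sub>m k)"
  proof (rule psdI)
    show "hermitian k (P - complex_of_real c \<cdot>\<^sub>m 1\<^sub>m k)"
      by (intro hermitian_minus hermitian_smult pdD(1) P pd_one)
    fix x :: "complex vec" assume x: "x \<in> carrier_vec k"
    have "c * rqform (1\<^sub>m k) x \<le> rqform P x"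
      unfolding qform_spectral[OF s(1) x] unitary_norm[OF U x, symmetric] Re_complex_of_real sum_distrib_left
      using c by (intro sum_mono mult_right_mono) auto
    thus "0 \<le> rqform (P - complex_of_real c \<cdot>\<^sub>m 1\<^sub>m k) x"
      using x Pc by (simp add: qform_minus[of _ k] qform_smult[of _ k])
  qed
  hence "psd n (\<Phi> (P - complex_of_real c \<cdot>\<^sub>m 1\<^sub>m k))" using \<Phi>(2) by (simp add: positive_map_def)
  also have "\<Phi> (P - complex_of_real c \<cdot>\<^sub>m 1\<^sub>m k) = \<Phi> P - complex_of_real c \<cdot>\<^sub>m 1\<^sub>m n"
    using Pc \<Phi>(3) by (simp add: linear_mat_mapD[OF \<Phi>(1)] unital_map_def)
  finally have p: "psd n (\<Phi> P - complex_of_real c \<cdot>\<^sub>m 1\<^sub>m n)" .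
  fix x :: "complex vec" assume x: "x \<in> carrier_vec n" "x \<noteq> 0\<^sub>v n"
  have "c * rqform (1\<^sub>m n) x \<le> rqform (\<Phi> P) x"
    using psdD(3)[OF p x(1)] x(1) linear_mat_mapD(1)[OF \<Phi>(1) Pc]
    by (simp add: qform_minus[of _ n] qform_smult[of _ n])
  moreover have "0 < c * rqform (1\<^sub>m n) x" using c(1) rqform_one_pos[OF x] by simp
  ultimately show "0 < rqform (\<Phi> P) x" by linarith
qed

lemma positive_map_mat_fun_concave:
  assumes \<Phi>: "linear_mat_map k n \<Phi>" "positive_map k n \<Phi>"
    and f: "operator_monotone_pos f" "\<And>t. 0 < t \<Longrightarrow> 0 \<le> f t" and A: "pd k A" and B: "pd k B"
    and l: "0 \<le> l" "l \<le> 1"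
  shows "psd n (\<Phi> (mat_fun f (complex_of_real (1 - l) \<cdot>\<^sub>m A + complex_of_real l \<cdot>\<^sub>m B))
    - (complex_of_real (1 - l) \<cdot>\<^sub>m \<Phi> (mat_fun f A) + complex_of_real l \<cdot>\<^sub>m \<Phi> (mat_fun f B)))"
proof -
  have c: "mat_fun f M \<in> carrier_mat k k" if "pd k M" for M
    using pd_spectral[OF that] spectral_mat_fun spectral_carrier by metis
  note c' = c[OF A] c[OF B] c[OF pd_convex[OF A B l]]
  from operator_monotone_concave[OF f A B l] \<Phi>(2)
  show ?thesis using c' unfolding positive_map_def
    by (auto simp: linear_mat_mapD[OF \<Phi>(1)] dest!: spec mp)
qed

section \<open>Variational formulas for the kernels\<close>

lemma mtrace_mult:
  assumes "A \<in> carrier_mat r c" "B \<in> carrier_mat c r"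
  shows "mtrace (A * B) = (\<Sum>i<r. \<Sum>j<c. A $$ (i,j) * B $$ (j,i))"
  using assms by (auto simp: mtrace_def scalar_prod_def lessThan_atLeast0 intro!: sum.cong)

lemma mtrace_comm:
  assumes "A \<in> carrier_mat r c" "B \<in> carrier_mat c r"
  shows "mtrace (A * B) = mtrace (B * A)"
  unfolding mtrace_mult[OF assms] mtrace_mult[OF assms(2,1)]
  by (subst sum.swap) (simp add: mult.commute)

definition tform :: "complex mat \<Rightarrow> complex mat \<Rightarrow> complex mat \<Rightarrow> real" where
  "tform X Y K = Re (mtrace (X * cadj K * Y * K))"

lemma tform_eq:
  assumes "X \<in> carrier_mat n n" "Y \<in> carrier_mat n n" "K \<in> carrier_mat n n"
  shows "tform X Y K = Re (mtrace (X * (cadj K * Y * K)))"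
  using assms by (simp add: tform_def mult_mat_assoc)

text \<open>Cyclicity of the trace exchanges the two outer arguments, so facts about the first one
  transfer to the second with \<open>K\<close> replaced by its adjoint.\<close>

lemma tform_swap:
  assumes "X \<in> carrier_mat n n" "Y \<in> carrier_mat n n" "K \<in> carrier_mat n n"
  shows "tform X Y K = tform Y X (cadj K)"
proof -
  have "mtrace ((X * cadj K) * (Y * K)) = mtrace ((Y * K) * (X * cadj K))"
    using assms by (intro mtrace_comm[of _ n n]) auto
  thus ?thesis using assms by (simp add: tform_def mult_mat_assoc)
qed

lemma tform_spectral:
  assumes X: "spectral n X U d" and Y: "spectral n Y V e" and K: "K \<in> carrier_mat n n"
  shows "tform X Y K = (\<Sum>i<n. \<Sum>j<n. d i * e j * (cmod ((cadj V * K * U) $$ (j,i)))\<^sup>2)"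
proof -
  have U: "unitary n U" "X = U * rdiag n d * cadj U" and V: "unitary n V" "Y = V * rdiag n e * cadj V"
    using X Y by (auto simp: spectral_def)
  note dims = unitary_dims[OF U(1)] unitary_dims[OF V(1)]
  define M where "M = cadj V * K * U"
  have M: "M \<in> carrier_mat n n" using dims by (auto simp: M_def)
  have Uc: "U \<in> carrier_mat n n" by (rule unitaryD(1)[OF U(1)])
  \<comment> \<open>\<open>R\<close> is the product without its leading \<open>U\<close>. Cyclicity
    moves that factor to the end, where it completes the second copy of \<open>M\<close>.\<close>
  define R where "R = rdiag n d * (cadj U * (cadj K * (V * (rdiag n e * (cadj V * K)))))"
  have R: "R \<in> carrier_mat n n" using K dims by (auto simp: R_def)
  have "X * cadj K * Y * K = U * R"
    using K dims by (simp add: U(2) V(2) R_def mult_mat_assoc)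
  hence "mtrace (X * cadj K * Y * K) = mtrace (R * U)" using mtrace_comm[OF Uc R] by simp
  also have "R * U = (rdiag n d * cadj M) * (rdiag n e * M)"
    using K dims by (simp add: R_def M_def mult_mat_assoc cadj_mult)
  also have "mtrace \<dots> = (\<Sum>i<n. \<Sum>j<n. (rdiag n d * cadj M) $$ (i,j) * (rdiag n e * M) $$ (j,i))"
    using M by (intro mtrace_mult) auto
  also have "\<dots> = (\<Sum>i<n. \<Sum>j<n. complex_of_real (d i * e j * (cmod (M $$ (j,i)))\<^sup>2))"
  proof (intro sum.cong refl)
    fix i j assume "i \<in> {..<n}" "j \<in> {..<n}"
    thus "(rdiag n d * cadj M) $$ (i,j) * (rdiag n e * M) $$ (j,i)
        = complex_of_real (d i * e j * (cmod (M $$ (j,i)))\<^sup>2)"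
      using M unfolding of_real_mult complex_norm_square
      by (simp add: mat_diag_mult_left[OF M] mat_diag_mult_left[OF cadj_carrier[OF M]] mult_ac)
  qed
  finally show ?thesis unfolding tform_def M_def[symmetric] by (simp del: of_real_mult)
qed

text \<open>The trace is linear in its first argument and nonnegative on pairs of positive
  semidefinite matrices, so it is applied to the residual \<open>P\<close>. Working with a residual
  instead of an exact combination covers concavity and monotonicity together.\<close>

lemma tform_concave_left:
  assumes psd: "psd n (X0 - (complex_of_real a \<cdot>\<^sub>m X1 + complex_of_real b \<cdot>\<^sub>m X2))" "psd n Y"
    and c: "X0 \<in> carrier_mat n n" "X1 \<in> carrier_mat n n" "X2 \<in> carrier_mat n n" "K \<in> carrier_mat n n"
  shows "a * tform X1 Y K + b * tform X2 Y K \<le> tform X0 Y K"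
proof -
  define P where "P = X0 - (complex_of_real a \<cdot>\<^sub>m X1 + complex_of_real b \<cdot>\<^sub>m X2)"
  have P: "P \<in> carrier_mat n n" using psd(1) unfolding P_def by (rule psdD(2))
  have Y: "Y \<in> carrier_mat n n" using psd(2) by (rule psdD(2))
  define R where "R = cadj K * Y * K"
  have R: "R \<in> carrier_mat n n" using c Y by (auto simp: R_def)
  obtain U d where sP: "spectral n P U d" using psd(1) psdD(1) hermitian_spectral unfolding P_def by metis
  obtain V e where sY: "spectral n Y V e" using psd(2) psdD(1) hermitian_spectral by metis
  have "0 \<le> tform P Y K"
    unfolding tform_spectral[OF sP sY c(4)]
    using spectral_psd[OF sP] spectral_psd[OF sY psd(2)] psd(1) by (auto simp: P_def intro!: sum_nonneg)
  also have "tform P Y K = Re (mtrace (P * R))" unfolding R_def by (rule tform_eq[OF P Y c(4)])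
  also have "mtrace (P * R) = mtrace (X0 * R) - (complex_of_real a * mtrace (X1 * R) + complex_of_real b * mtrace (X2 * R))"
    unfolding mtrace_mult[OF P R] mtrace_mult[OF c(1) R] mtrace_mult[OF c(2) R] mtrace_mult[OF c(3) R]
      sum_distrib_left sum.distrib[symmetric] sum_subtractf[symmetric]
    using c by (intro sum.cong refl) (auto simp: P_def algebra_simps)
  also have "Re \<dots> = tform X0 Y K - (a * tform X1 Y K + b * tform X2 Y K)"
    using c Y by (simp add: tform_eq[of _ n] R_def)
  finally show ?thesis by simp
qed

lemma tform_concave_right:
  assumes "psd n (Y0 - (complex_of_real a \<cdot>\<^sub>m Y1 + complex_of_real b \<cdot>\<^sub>m Y2))" "psd n X"
    and c: "Y0 \<in> carrier_mat n n" "Y1 \<in> carrier_mat n n" "Y2 \<in> carrier_mat n n" "K \<in> carrier_mat n n"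
  shows "a * tform X Y1 K + b * tform X Y2 K \<le> tform X Y0 K"
  using tform_concave_left[OF assms(1,2) c(1,2,3) cadj_carrier[OF c(4)]] c psdD(2)[OF assms(2)]
  by (simp add: tform_swap[of X n])

text \<open>One decomposition is fixed per matrix, so that sums for different kernels and different
  \<open>K\<close> are taken in the same coordinates and can be compared termwise.\<close>

definition eigs :: "nat \<Rightarrow> complex mat \<Rightarrow> complex mat \<times> (nat \<Rightarrow> real)" where
  "eigs n X = (SOME (U, d). spectral n X U d)"

abbreviation "evecs n X \<equiv> fst (eigs n X)"
abbreviation "evals n X \<equiv> snd (eigs n X)"

lemma eigs_spectral:
  assumes "hermitian n X"
  shows "spectral n X (evecs n X) (evals n X)"
proof -
  obtain U d where "spectral n X U d" using hermitian_spectral[OF assms] .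
  hence "case eigs n X of (U, d) \<Rightarrow> spectral n X U d"
    unfolding eigs_def by (intro someI[of "\<lambda>(U, d). spectral n X U d" "(U, d)"]) simp
  thus ?thesis by (simp add: case_prod_beta)
qed

lemma pd_eigs:
  assumes "pd n X"
  shows "spectral n X (evecs n X) (evals n X)" "i < n \<Longrightarrow> 0 < evals n X i"
  using eigs_spectral[OF pdD(1)[OF assms]] spectral_pd assms by blast+

text \<open>Index \<open>i\<close> belongs to the eigenvectors of \<open>X\<close> and
  \<open>j\<close> to those of \<open>Y\<close>, whence the transposed position (j,i).\<close>

definition coord :: "nat \<Rightarrow> complex mat \<Rightarrow> complex mat \<Rightarrow> complex mat \<Rightarrow> nat \<Rightarrow> nat \<Rightarrow> complex" where
  "coord n X Y K i j = (cadj (evecs n Y) * K * evecs n X) $$ (j,i)"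

text \<open>The quadratic form in K of the commuting operators of right multiplication by X and left
  multiplication by Y, under the joint functional calculus h.\<close>
definition dform :: "nat \<Rightarrow> (real \<Rightarrow> real \<Rightarrow> real) \<Rightarrow> complex mat \<Rightarrow> complex mat \<Rightarrow> complex mat \<Rightarrow> real" where
  "dform n h X Y K = (\<Sum>i<n. \<Sum>j<n. h (evals n X i) (evals n Y j) * (cmod (coord n X Y K i j))\<^sup>2)"

lemma tform_mat_fun:
  assumes "pd n X" "pd n Y" "K \<in> carrier_mat n n"
  shows "tform (mat_fun f X) (mat_fun g Y) K = dform n (\<lambda>x y. f x * g y) X Y K"
  unfolding dform_def coord_def
  by (rule tform_spectral) (intro spectral_mat_fun pd_eigs assms)+

lemma spectral_one: "unitary n U \<Longrightarrow> spectral n (1\<^sub>m n) U (\<lambda>_. 1)"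
  using unitaryD[of n U] by (simp add: spectral_def right_mult_one_mat[of _ n n])

text \<open>The identity is diagonal in every orthonormal basis, in particular in that of the matrix
  absent from the trace. So these three kernels give forms that depend on \<open>X\<close> alone, on
  \<open>Y\<close> alone, or on neither, although \<open>coord\<close> uses both eigenbases. They
  are the building blocks of the affine expressions in the extremal formulas.\<close>

lemma tform_dform:
  assumes X: "pd n X" and Y: "pd n Y" and K: "K \<in> carrier_mat n n"
  shows "tform X (1\<^sub>m n) K = dform n (\<lambda>x y. x) X Y K"
    and "tform (1\<^sub>m n) Y K = dform n (\<lambda>x y. y) X Y K"
    and "tform (1\<^sub>m n) (1\<^sub>m n) K = dform n (\<lambda>x y. 1) X Y K"
proof -
  note s = pd_eigs(1)[OF X] pd_eigs(1)[OF Y]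
  have u: "unitary n (evecs n X)" "unitary n (evecs n Y)" using s by (auto simp: spectral_def)
  show "tform X (1\<^sub>m n) K = dform n (\<lambda>x y. x) X Y K"
    using tform_spectral[OF s(1) spectral_one[OF u(2)] K] by (simp add: dform_def coord_def)
  show "tform (1\<^sub>m n) Y K = dform n (\<lambda>x y. y) X Y K"
    using tform_spectral[OF spectral_one[OF u(1)] s(2) K] by (simp add: dform_def coord_def)
  show "tform (1\<^sub>m n) (1\<^sub>m n) K = dform n (\<lambda>x y. 1) X Y K"
    using tform_spectral[OF spectral_one[OF u(1)] spectral_one[OF u(2)] K] by (simp add: dform_def coord_def)
qed

section \<open>Extremal problems solved coordinate by coordinate\<close>

lemma coord_minus:
  assumes X: "pd n X" and Y: "pd n Y" and "K \<in> carrier_mat n n" "Z \<in> carrier_mat n n" "i < n" "j < n"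
  shows "coord n X Y (K - Z) i j = coord n X Y K i j - coord n X Y Z i j"
proof -
  have c: "cadj (evecs n Y) \<in> carrier_mat n n" "evecs n X \<in> carrier_mat n n"
    using pd_eigs(1)[OF X] pd_eigs(1)[OF Y] by (auto simp: spectral_def unitary_def)
  have "cadj (evecs n Y) * (K - Z) * evecs n X
      = cadj (evecs n Y) * K * evecs n X - cadj (evecs n Y) * Z * evecs n X"
    using c assms by (simp add: mult_minus_distrib_mat[of _ n n] minus_mult_distrib_mat[of _ n n])
  thus ?thesis
    using carrier_matD[OF c(1)] carrier_matD[OF c(2)] carrier_matD[OF assms(4)] assms(5,6)
    unfolding coord_def by simp
qed

text \<open>An entrywise (Schur) multiplier in the two eigenbases, transformed back. It assembles
  the scalar optimisers, one for each pair of eigenvalues, into a single matrix.\<close>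

lemma coord_multiplier:
  assumes X: "pd n X" and Y: "pd n Y" and K: "K \<in> carrier_mat n n"
  obtains Z where "Z \<in> carrier_mat n n"
    "\<And>i j. i < n \<Longrightarrow> j < n \<Longrightarrow> coord n X Y Z i j = complex_of_real (g (evals n X i) (evals n Y j)) * coord n X Y K i j"
proof -
  have u: "unitary n (evecs n X)" "unitary n (evecs n Y)"
    using pd_eigs(1)[OF X] pd_eigs(1)[OF Y] by (auto simp: spectral_def)
  define N where "N = Matrix.mat n n (\<lambda>(j,i). complex_of_real (g (evals n X i) (evals n Y j)) * coord n X Y K i j)"
  define Z where "Z = evecs n Y * N * cadj (evecs n X)"
  have N: "N \<in> carrier_mat n n" by (simp add: N_def)
  have "cadj (evecs n Y) * Z * evecs n X = N"
    using N unitary_dims[OF u(1)] unitary_dims[OF u(2)] unitaryD[OF u(1)]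
    by (simp add: Z_def mult_mat_assoc unitary_cancel[OF u(2)] right_mult_one_mat[of _ n n])
  hence "coord n X Y Z i j = complex_of_real (g (evals n X i) (evals n Y j)) * coord n X Y K i j"
    if "i < n" "j < n" for i j
    using that by (simp add: coord_def[of n X Y Z] N_def)
  moreover have "Z \<in> carrier_mat n n" using unitaryD(1)[OF u(1)] unitaryD(1)[OF u(2)] N by (auto simp: Z_def)
  ultimately show ?thesis using that by blast
qed

text \<open>The kernel is the parallel sum of \<open>x / t\<close> and \<open>y\<close>: the least
  energy for splitting \<open>m\<close> into \<open>z\<close> and \<open>m - z\<close> with these
  two weights. The triangle inequality reduces to nonnegative reals, where the gap, after clearing
  denominators, is the square of \<open>x * a - t * y * b\<close>.\<close>

lemma parallel_kernel_le:
  fixes x y t :: real and m z :: complex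
  assumes "0 < x" "0 < y" "0 < t"
  shows "x * y / (x + t * y) * (cmod m)\<^sup>2 \<le> x / t * (cmod z)\<^sup>2 + y * (cmod (m - z))\<^sup>2"
proof -
  define a b where "a = cmod z" and "b = cmod (m - z)"
  have "cmod m \<le> a + b" unfolding a_def b_def using norm_triangle_ineq[of z "m - z"] by simp
  hence m: "(cmod m)\<^sup>2 \<le> (a + b)\<^sup>2" by (intro power_mono) auto
  have pos: "0 < x + t * y" using assms by (simp add: add_pos_pos)
  have "0 \<le> (x * a - t * y * b)\<^sup>2" by simp
  hence "t * (x * y) * (a + b)\<^sup>2 \<le> (x * a\<^sup>2 + t * y * b\<^sup>2) * (x + t * y)"
    by (simp add: power2_eq_square algebra_simps)
  hence "x * y * (a + b)\<^sup>2 / (x + t * y) \<le> (x * a\<^sup>2 + t * y * b\<^sup>2) / t"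
    using pos assms(3) by (simp add: field_simps)
  also have "\<dots> = x / t * a\<^sup>2 + y * b\<^sup>2" using assms by (simp add: field_simps)
  finally have "x * y / (x + t * y) * (a + b)\<^sup>2 \<le> x / t * a\<^sup>2 + y * b\<^sup>2" by simp
  moreover have "x * y / (x + t * y) * (cmod m)\<^sup>2 \<le> x * y / (x + t * y) * (a + b)\<^sup>2"
    using m assms pos by (intro mult_left_mono) auto
  ultimately show ?thesis by (simp add: a_def b_def)
qed

text \<open>The optimal splitting takes both parts as nonnegative multiples of \<open>m\<close> in
  the ratio \<open>t * y : x\<close>, which makes the triangle inequality and the square in
  \<open>parallel_kernel_le\<close> exact.\<close>

lemma parallel_kernel_eq:
  fixes x y t :: real and m :: complex
  assumes "0 < x" "0 < y" "0 < t"
  shows "x / t * (cmod (complex_of_real (t * y / (x + t * y)) * m))\<^sup>2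
    + y * (cmod (m - complex_of_real (t * y / (x + t * y)) * m))\<^sup>2 = x * y / (x + t * y) * (cmod m)\<^sup>2"
proof -
  have pos: "0 < x + t * y" using assms by (simp add: add_pos_pos)
  define s where "s = t * y / (x + t * y)"
  have "x + t * y - t * y = x" by simp
  hence s1: "1 - s = x / (x + t * y)" unfolding s_def using pos by (simp add: field_simps)
  have "m - complex_of_real s * m = complex_of_real (1 - s) * m" by (simp add: algebra_simps)
  hence "x / t * (cmod (complex_of_real s * m))\<^sup>2 + y * (cmod (m - complex_of_real s * m))\<^sup>2
     = (x / t * s\<^sup>2 + y * (1 - s)\<^sup>2) * (cmod m)\<^sup>2"
    by (simp add: norm_mult power_mult_distrib distrib_right del: of_real_diff)
  also have "x / t * s\<^sup>2 + y * (1 - s)\<^sup>2 = x * y * (x + t * y) / (x + t * y)\<^sup>2"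
    unfolding s1 using assms by (simp add: s_def power_divide power2_eq_square add_divide_distrib[symmetric] algebra_simps)
  also have "\<dots> = x * y / (x + t * y)" using pos by (simp add: power2_eq_square)
  finally show ?thesis by (simp add: s_def)
qed

text \<open>The first three terms are a polarised 2 Re (m * cnj z). In this form the bilinear term
  consists of squared norms only, so it becomes \<open>tform\<close> at \<open>K\<close>,
  \<open>Z\<close> and \<open>K - Z\<close>. It is at most 2 |m| |z|, and completing the square in
  |z| does the rest.\<close>

lemma inverse_kernel_le:
  fixes r :: real and m z :: complex
  assumes "0 < r"
  shows "(cmod m)\<^sup>2 + (cmod z)\<^sup>2 - (cmod (m - z))\<^sup>2 - r * (cmod z)\<^sup>2 \<le> (cmod m)\<^sup>2 / r"
proof -
  have "(cmod m - cmod z)\<^sup>2 \<le> (cmod (m - z))\<^sup>2"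
    using norm_triangle_ineq3[of m z] by (metis abs_norm_cancel abs_le_square_iff)
  hence "(cmod m)\<^sup>2 + (cmod z)\<^sup>2 - (cmod (m - z))\<^sup>2 \<le> 2 * cmod m * cmod z" by (simp add: power2_diff)
  moreover have "0 \<le> (cmod m - r * cmod z)\<^sup>2 / r" using assms by simp
  hence "2 * cmod m * cmod z \<le> (cmod m)\<^sup>2 / r + r * (cmod z)\<^sup>2"
    using assms by (simp add: power2_eq_square field_simps)
  ultimately show ?thesis by linarith
qed

lemma inverse_kernel_eq:
  fixes r :: real and m :: complex
  assumes "0 < r"
  shows "(cmod m)\<^sup>2 + (cmod (complex_of_real (1 / r) * m))\<^sup>2 - (cmod (m - complex_of_real (1 / r) * m))\<^sup>2
    - r * (cmod (complex_of_real (1 / r) * m))\<^sup>2 = (cmod m)\<^sup>2 / r"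
proof -
  have "m - complex_of_real (1 / r) * m = complex_of_real (1 - 1 / r) * m" by (simp add: algebra_simps)
  hence e1: "(cmod (m - complex_of_real (1 / r) * m))\<^sup>2 = (1 - 1 / r)\<^sup>2 * (cmod m)\<^sup>2"
    by (simp only: norm_mult power_mult_distrib norm_of_real power2_abs)
  have e2: "(cmod (complex_of_real (1 / r) * m))\<^sup>2 = (1 / r)\<^sup>2 * (cmod m)\<^sup>2"
    by (simp only: norm_mult power_mult_distrib norm_of_real power2_abs)
  show ?thesis unfolding e1 e2 using assms by (simp add: power2_eq_square field_simps)
qed

lemma dform_parallel_le:
  assumes X: "pd n X" and Y: "pd n Y" and K: "K \<in> carrier_mat n n" and Z: "Z \<in> carrier_mat n n" and t: "0 < t"
  shows "dform n (\<lambda>x y. x * y / (x + t * y)) X Y K \<le> tform X (1\<^sub>m n) Z / t + tform (1\<^sub>m n) Y (K - Z)"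
proof -
  have KZ: "K - Z \<in> carrier_mat n n" using K Z by auto
  show ?thesis
    unfolding tform_dform(1)[OF X Y Z] tform_dform(2)[OF X Y KZ] dform_def sum_divide_distrib sum.distrib[symmetric]
  proof (intro sum_mono)
    fix i j assume "i \<in> {..<n}" "j \<in> {..<n}"
    hence ij: "i < n" "j < n" by auto
    show "evals n X i * evals n Y j / (evals n X i + t * evals n Y j) * (cmod (coord n X Y K i j))\<^sup>2
       \<le> evals n X i * (cmod (coord n X Y Z i j))\<^sup>2 / t + evals n Y j * (cmod (coord n X Y (K - Z) i j))\<^sup>2"
      using parallel_kernel_le[OF pd_eigs(2)[OF X ij(1)] pd_eigs(2)[OF Y ij(2)] t]
      by (simp add: coord_minus[OF X Y K Z ij])
  qed
qed

lemma dform_parallel_attained: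
  assumes X: "pd n X" and Y: "pd n Y" and K: "K \<in> carrier_mat n n" and t: "0 < t"
  obtains Z where "Z \<in> carrier_mat n n"
    "dform n (\<lambda>x y. x * y / (x + t * y)) X Y K = tform X (1\<^sub>m n) Z / t + tform (1\<^sub>m n) Y (K - Z)"
proof -
  obtain Z where Z: "Z \<in> carrier_mat n n" "\<And>i j. i < n \<Longrightarrow> j < n \<Longrightarrow> coord n X Y Z i j
      = complex_of_real (t * evals n Y j / (evals n X i + t * evals n Y j)) * coord n X Y K i j"
    using coord_multiplier[OF X Y K, of "\<lambda>x y. t * y / (x + t * y)"] by blast
  have KZ: "K - Z \<in> carrier_mat n n" using K Z by auto
  have "dform n (\<lambda>x y. x * y / (x + t * y)) X Y K = tform X (1\<^sub>m n) Z / t + tform (1\<^sub>m n) Y (K - Z)"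
    unfolding tform_dform(1)[OF X Y Z(1)] tform_dform(2)[OF X Y KZ] dform_def sum_divide_distrib sum.distrib[symmetric]
  proof (intro sum.cong refl)
    fix i j assume "i \<in> {..<n}" "j \<in> {..<n}"
    hence ij: "i < n" "j < n" by auto
    show "evals n X i * evals n Y j / (evals n X i + t * evals n Y j) * (cmod (coord n X Y K i j))\<^sup>2
       = evals n X i * (cmod (coord n X Y Z i j))\<^sup>2 / t + evals n Y j * (cmod (coord n X Y (K - Z) i j))\<^sup>2"
      using parallel_kernel_eq[OF pd_eigs(2)[OF X ij(1)] pd_eigs(2)[OF Y ij(2)] t, of "coord n X Y K i j"]
      unfolding coord_minus[OF X Y K Z(1) ij] Z(2)[OF ij] by simp
  qed
  thus ?thesis using that Z(1) by blast
qed

lemma dform_inverse_ge: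
  assumes X: "pd n X" and Y: "pd n Y" and K: "K \<in> carrier_mat n n" and Z: "Z \<in> carrier_mat n n" and t: "0 < t"
  shows "tform (1\<^sub>m n) (1\<^sub>m n) K + tform (1\<^sub>m n) (1\<^sub>m n) Z - tform (1\<^sub>m n) (1\<^sub>m n) (K - Z)
      - (tform X (1\<^sub>m n) Z + t * tform (1\<^sub>m n) Y Z) \<le> dform n (\<lambda>x y. 1 / (x + t * y)) X Y K"
proof -
  have KZ: "K - Z \<in> carrier_mat n n" using K Z by auto
  show ?thesis
    unfolding tform_dform[OF X Y Z] tform_dform(3)[OF X Y KZ] tform_dform(3)[OF X Y K] dform_def
      sum_distrib_left sum.distrib[symmetric] sum_subtractf[symmetric]
  proof (intro sum_mono)
    fix i j assume "i \<in> {..<n}" "j \<in> {..<n}"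
    hence ij: "i < n" "j < n" by auto
    have "0 < evals n X i + t * evals n Y j"
      using pd_eigs(2)[OF X ij(1)] pd_eigs(2)[OF Y ij(2)] t by (simp add: add_pos_pos)
    from inverse_kernel_le[OF this, of "coord n X Y K i j" "coord n X Y Z i j"]
    show "1 * (cmod (coord n X Y K i j))\<^sup>2 + 1 * (cmod (coord n X Y Z i j))\<^sup>2 - 1 * (cmod (coord n X Y (K - Z) i j))\<^sup>2
       - (evals n X i * (cmod (coord n X Y Z i j))\<^sup>2 + t * (evals n Y j * (cmod (coord n X Y Z i j))\<^sup>2))
       \<le> 1 / (evals n X i + t * evals n Y j) * (cmod (coord n X Y K i j))\<^sup>2"
      by (simp add: coord_minus[OF X Y K Z ij] algebra_simps)
  qed
qed

lemma dform_inverse_attained: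
  assumes X: "pd n X" and Y: "pd n Y" and K: "K \<in> carrier_mat n n" and t: "0 < t"
  obtains Z where "Z \<in> carrier_mat n n"
    "dform n (\<lambda>x y. 1 / (x + t * y)) X Y K = tform (1\<^sub>m n) (1\<^sub>m n) K + tform (1\<^sub>m n) (1\<^sub>m n) Z
      - tform (1\<^sub>m n) (1\<^sub>m n) (K - Z) - (tform X (1\<^sub>m n) Z + t * tform (1\<^sub>m n) Y Z)"
proof -
  obtain Z where Z: "Z \<in> carrier_mat n n" "\<And>i j. i < n \<Longrightarrow> j < n \<Longrightarrow> coord n X Y Z i j
      = complex_of_real (1 / (evals n X i + t * evals n Y j)) * coord n X Y K i j"
    using coord_multiplier[OF X Y K, of "\<lambda>x y. 1 / (x + t * y)"] by blast
  have KZ: "K - Z \<in> carrier_mat n n" using K Z by auto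
  have "dform n (\<lambda>x y. 1 / (x + t * y)) X Y K = tform (1\<^sub>m n) (1\<^sub>m n) K + tform (1\<^sub>m n) (1\<^sub>m n) Z
      - tform (1\<^sub>m n) (1\<^sub>m n) (K - Z) - (tform X (1\<^sub>m n) Z + t * tform (1\<^sub>m n) Y Z)"
    unfolding tform_dform[OF X Y Z(1)] tform_dform(3)[OF X Y KZ] tform_dform(3)[OF X Y K] dform_def
      sum_distrib_left sum.distrib[symmetric] sum_subtractf[symmetric]
  proof (intro sum.cong refl)
    fix i j assume "i \<in> {..<n}" "j \<in> {..<n}"
    hence ij: "i < n" "j < n" by auto
    define r where "r = evals n X i + t * evals n Y j"
    have r: "0 < r"
      using pd_eigs(2)[OF X ij(1)] pd_eigs(2)[OF Y ij(2)] t by (simp add: add_pos_pos r_def)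
    define m where "m = coord n X Y K i j"
    define z where "z = complex_of_real (1 / r) * m"
    have z: "coord n X Y Z i j = z" unfolding Z(2)[OF ij] z_def r_def m_def ..
    have "evals n X i * (cmod z)\<^sup>2 + t * (evals n Y j * (cmod z)\<^sup>2) = r * (cmod z)\<^sup>2"
      by (simp add: r_def algebra_simps)
    moreover have "(cmod m)\<^sup>2 + (cmod z)\<^sup>2 - (cmod (m - z))\<^sup>2 - r * (cmod z)\<^sup>2 = (cmod m)\<^sup>2 / r"
      unfolding z_def by (rule inverse_kernel_eq[OF r])
    ultimately show "1 / (evals n X i + t * evals n Y j) * (cmod (coord n X Y K i j))\<^sup>2
      = 1 * (cmod (coord n X Y K i j))\<^sup>2 + 1 * (cmod (coord n X Y Z i j))\<^sup>2 - 1 * (cmod (coord n X Y (K - Z) i j))\<^sup>2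
       - (evals n X i * (cmod (coord n X Y Z i j))\<^sup>2 + t * (evals n Y j * (cmod (coord n X Y Z i j))\<^sup>2))"
      unfolding coord_minus[OF X Y K Z(1) ij] z m_def[symmetric] r_def[symmetric] by simp
  qed
  thus ?thesis using that Z(1) by blast
qed

text \<open>What operator concavity yields for the images of a convex combination and of its two
  endpoints. An inequality proved under this relation contains concavity (residual zero) as well as
  monotonicity (\<open>X1 = X2\<close>).\<close>

definition above_mix :: "nat \<Rightarrow> real \<Rightarrow> complex mat \<Rightarrow> complex mat \<Rightarrow> complex mat \<Rightarrow> bool" where
  "above_mix n l X0 X1 X2 \<longleftrightarrow> pd n X0 \<and> pd n X1 \<and> pd n X2
     \<and> psd n (X0 - (complex_of_real (1 - l) \<cdot>\<^sub>m X1 + complex_of_real l \<cdot>\<^sub>m X2))"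

lemma above_mix_pd: "above_mix n l X0 X1 X2 \<Longrightarrow> pd n X0" "above_mix n l X0 X1 X2 \<Longrightarrow> pd n X1"
  "above_mix n l X0 X1 X2 \<Longrightarrow> pd n X2"
  by (auto simp: above_mix_def)

lemma tform_above_mix:
  assumes X: "above_mix n l X0 X1 X2" and Y: "above_mix n l Y0 Y1 Y2" and K: "K \<in> carrier_mat n n"
  shows "(1 - l) * tform X1 (1\<^sub>m n) K + l * tform X2 (1\<^sub>m n) K \<le> tform X0 (1\<^sub>m n) K"
    and "(1 - l) * tform (1\<^sub>m n) Y1 K + l * tform (1\<^sub>m n) Y2 K \<le> tform (1\<^sub>m n) Y0 K"
  using tform_concave_left[OF _ pdD(3)[OF pd_one] _ _ _ K, of X0 "1 - l" X1 l X2]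
    tform_concave_right[OF _ pdD(3)[OF pd_one] _ _ _ K, of Y0 "1 - l" Y1 l Y2] X Y
  unfolding above_mix_def by (simp_all add: pdD(2))

text \<open>The minimiser \<open>Z\<close> for (X0, Y0) is only a trial matrix for the other two
  pairs, so their values are bounded above by traces with the same \<open>Z\<close>. These traces
  are linear in X and Y and respect \<open>above_mix\<close>.\<close>

lemma parallel_kernel_concave:
  assumes l: "0 \<le> l" "l \<le> 1" and X: "above_mix n l X0 X1 X2" and Y: "above_mix n l Y0 Y1 Y2"
    and K: "K \<in> carrier_mat n n" and t: "0 < t"
  defines "h \<equiv> \<lambda>x y. x * y / (x + t * y)"
  shows "(1 - l) * dform n h X1 Y1 K + l * dform n h X2 Y2 K \<le> dform n h X0 Y0 K"
proof -
  obtain Z where Z: "Z \<in> carrier_mat n n"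
    "dform n h X0 Y0 K = tform X0 (1\<^sub>m n) Z / t + tform (1\<^sub>m n) Y0 (K - Z)"
    using dform_parallel_attained[OF above_mix_pd(1)[OF X] above_mix_pd(1)[OF Y] K t] unfolding h_def by blast
  have KZ: "K - Z \<in> carrier_mat n n" using K Z by auto
  let ?F = "\<lambda>X Y. tform X (1\<^sub>m n) Z / t + tform (1\<^sub>m n) Y (K - Z)"
  have "(1 - l) * dform n h X1 Y1 K + l * dform n h X2 Y2 K \<le> (1 - l) * ?F X1 Y1 + l * ?F X2 Y2"
    using l unfolding h_def
    by (intro add_mono mult_left_mono dform_parallel_le K Z t above_mix_pd[OF X] above_mix_pd[OF Y]) auto
  also have "\<dots> = ((1 - l) * tform X1 (1\<^sub>m n) Z + l * tform X2 (1\<^sub>m n) Z) / t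
      + ((1 - l) * tform (1\<^sub>m n) Y1 (K - Z) + l * tform (1\<^sub>m n) Y2 (K - Z))"
    by (simp add: add_divide_distrib distrib_left)
  also have "\<dots> \<le> ?F X0 Y0"
    using t tform_above_mix(1)[OF X Y Z(1)] tform_above_mix(2)[OF X Y KZ] by (intro add_mono divide_right_mono) auto
  finally show ?thesis using Z(2) by simp
qed

text \<open>Dual to the parallel case: the maximiser for (X0, Y0) gives lower bounds at the other
  two pairs, and the terms in X and Y enter with a minus sign.\<close>

lemma inverse_kernel_convex:
  assumes l: "0 \<le> l" "l \<le> 1" and X: "above_mix n l X0 X1 X2" and Y: "above_mix n l Y0 Y1 Y2"
    and K: "K \<in> carrier_mat n n" and t: "0 < t"
  defines "h \<equiv> \<lambda>x y. 1 / (x + t * y)"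
  shows "dform n h X0 Y0 K \<le> (1 - l) * dform n h X1 Y1 K + l * dform n h X2 Y2 K"
proof -
  \<comment> \<open>The part free of X and Y; it passes through the convex combination unchanged
    because the weights sum to 1.\<close>
  let ?c = "\<lambda>Z. tform (1\<^sub>m n) (1\<^sub>m n) K + tform (1\<^sub>m n) (1\<^sub>m n) Z - tform (1\<^sub>m n) (1\<^sub>m n) (K - Z)"
  let ?F = "\<lambda>Z X Y. tform X (1\<^sub>m n) Z + t * tform (1\<^sub>m n) Y Z"
  obtain Z where Z: "Z \<in> carrier_mat n n" "dform n h X0 Y0 K = ?c Z - ?F Z X0 Y0"
    using dform_inverse_attained[OF above_mix_pd(1)[OF X] above_mix_pd(1)[OF Y] K t] unfolding h_def by blast
  have "(1 - l) * tform X1 (1\<^sub>m n) Z + l * tform X2 (1\<^sub>m n) Z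
      + t * ((1 - l) * tform (1\<^sub>m n) Y1 Z + l * tform (1\<^sub>m n) Y2 Z) \<le> ?F Z X0 Y0"
    using t tform_above_mix[OF X Y Z(1)] by (intro add_mono mult_left_mono) auto
  hence "?c Z - ?F Z X0 Y0 \<le> (1 - l) * (?c Z - ?F Z X1 Y1) + l * (?c Z - ?F Z X2 Y2)"
    by (simp add: algebra_simps)
  also have "\<dots> \<le> (1 - l) * dform n h X1 Y1 K + l * dform n h X2 Y2 K"
    using l unfolding h_def
    by (intro add_mono mult_left_mono dform_inverse_ge K Z t above_mix_pd[OF X] above_mix_pd[OF Y]) auto
  finally show ?thesis using Z(2) by simp
qed

section \<open>Joint concavity and convexity\<close>

lemma has_bochner_integral_power_kernel:
  fixes a :: real
  assumes a: "0 < a" "a < 1"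
  obtains C where "0 < C" "has_bochner_integral lborel (\<lambda>t. indicator {0<..} t * (t powr (a - 1) / (1 + t))) C"
proof -
  define g where "g t = indicator {0<..} t * (t powr (a - 1) / (1 + t))" for t :: real
  \<comment> \<open>Majorants on the two sides of 1: t^(a-1) is integrable near 0 because a > 0, and
    t^(a-2) near infinity because a < 1.\<close>
  define h1 h2 where "h1 t = indicator {0..1} t * t powr (a - 1)" and "h2 t = indicator {1..} t * t powr (a - 2)" for t :: real
  have "(\<lambda>t. t powr (a - 1)) absolutely_integrable_on {0..1}"
    using integrable_on_powr_from_0[of "a - 1" 1] a by (intro nonnegative_absolutely_integrable_1) auto
  hence "integrable lebesgue h1" by (simp add: set_integrable_def h1_def[abs_def])
  hence h1: "integrable lborel h1" by (subst (asm) integrable_completion) (auto simp: h1_def[abs_def])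
  have "(\<lambda>t. t powr (a - 2)) integrable_on {1..}"
    using has_integral_powr_to_inf[of "a - 2" 1] a by (auto simp: integrable_on_def)
  hence "(\<lambda>t. t powr (a - 2)) absolutely_integrable_on {1..}"
    by (intro nonnegative_absolutely_integrable_1) auto
  hence "integrable lebesgue h2" by (simp add: set_integrable_def h2_def[abs_def])
  hence h2: "integrable lborel h2" by (subst (asm) integrable_completion) (auto simp: h2_def[abs_def])
  have g0: "0 \<le> g t" for t by (auto simp: g_def indicator_def)
  have le: "g t \<le> h1 t + h2 t" for t
  proof -
    consider "t \<le> 0" | "0 < t" "t \<le> 1" | "1 < t" by linarith
    thus ?thesis
    proof cases
      case 1
      thus ?thesis by (auto simp: g_def h1_def h2_def indicator_def)
    next
      case 2
      have "t powr (a - 1) / (1 + t) \<le> t powr (a - 1) / 1"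
        using 2 by (intro divide_left_mono) auto
      thus ?thesis using 2 by (auto simp: g_def h1_def h2_def indicator_def)
    next
      case 3
      have "t powr (a - 1) / (1 + t) \<le> t powr (a - 1) / t"
        using 3 by (intro divide_left_mono) auto
      also have "\<dots> = t powr (a - 2)" using 3 powr_diff[of t "a - 1" 1] by (simp add: diff_diff_add)
      finally show ?thesis using 3 by (auto simp: g_def h1_def h2_def indicator_def)
    qed
  qed
  have [measurable]: "g \<in> borel_measurable borel" unfolding g_def[abs_def] by measurable
  have g: "integrable lborel g"
  proof (rule Bochner_Integration.integrable_bound[OF Bochner_Integration.integrable_add[OF h1 h2]])
    have "norm (g t) \<le> norm (h1 t + h2 t)" for t using g0[of t] le[of t] by simp
    thus "AE t in lborel. norm (g t) \<le> norm (h1 t + h2 t)" by simp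
  qed simp
  \<comment> \<open>A crude bound for positivity: on [1,2] the power is at least 1/t \<ge> 1/2 and
    the denominator is at most 3.\<close>
  have "(\<integral>t. indicator {1..2::real} t * (1 / 6) \<partial>lborel) \<le> (\<integral>t. g t \<partial>lborel)"
  proof (rule integral_mono[OF _ g])
    fix t :: real
    show "indicator {1..2::real} t * (1 / 6) \<le> g t"
    proof (cases "t \<in> {1..2}")
      case True
      have "1 / 2 \<le> t powr (- 1)" using True by (simp add: powr_minus divide_simps)
      also have "\<dots> \<le> t powr (a - 1)" using True a by (intro powr_mono) auto
      finally have "(1 / 2) / 3 \<le> t powr (a - 1) / (1 + t)" using True by (intro frac_le) auto
      thus ?thesis using True by (simp add: g_def)
    qed (use g0 in simp)
  qed simp
  hence "0 < (\<integral>t. g t \<partial>lborel)" by simp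
  thus ?thesis using that has_bochner_integral_integrable[OF g] unfolding g_def by blast
qed

text \<open>C is the beta integral pi / sin (pi * a), of which only finiteness and positivity matter.\<close>
lemma has_bochner_integral_scaled_power_kernel:
  fixes a :: real
  assumes a: "0 < a" "a < 1"
  obtains C where "0 < C" "\<And>x y. 0 < x \<Longrightarrow> 0 < y \<Longrightarrow> has_bochner_integral lborel
    (\<lambda>t. indicator {0<..} t * t powr (a - 1) * (1 / (x + t * y))) (C * (x powr (a - 1) * y powr (- a)))"
proof -
  obtain C where C: "0 < C" "has_bochner_integral lborel (\<lambda>t. indicator {0<..} t * (t powr (a - 1) / (1 + t))) C"
    using has_bochner_integral_power_kernel[OF a] by blast
  have "has_bochner_integral lborel (\<lambda>t. indicator {0<..} t * t powr (a - 1) * (1 / (x + t * y)))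
      (C * (x powr (a - 1) * y powr (- a)))" if xy: "0 < x" "0 < y" for x y
  proof -
    \<comment> \<open>Replacing t by c t turns 1 + t into (x + t y) / x, so the two-variable kernel
      is a rescaling of the one-variable kernel. The summand 0 below is the translation part of the
      affine change of variables.\<close>
    define c where "c = y / x"
    have c: "0 < c" using xy by (simp add: c_def)
    have "has_bochner_integral lborel (\<lambda>t. indicator {0<..} (0 + c * t) * ((0 + c * t) powr (a - 1) / (1 + (0 + c * t)))) (C /\<^sub>R \<bar>c\<bar>)"
      using C(2) c by (subst (asm) lborel_has_bochner_integral_real_affine_iff[of c _ _ 0]) auto
    hence "has_bochner_integral lborel (\<lambda>t. (indicator {0<..} (0 + c * t) * ((0 + c * t) powr (a - 1) / (1 + (0 + c * t))))
        * (c powr (1 - a) / x)) (C /\<^sub>R \<bar>c\<bar> * (c powr (1 - a) / x))"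
      by (intro has_bochner_integral_mult_left)
    moreover have "(indicator {0<..} (0 + c * t) * ((0 + c * t) powr (a - 1) / (1 + (0 + c * t)))) * (c powr (1 - a) / x)
        = indicator {0<..} t * t powr (a - 1) * (1 / (x + t * y))" for t :: real
    proof (cases "0 < t")
      case True
      have "(c * t) powr (a - 1) * c powr (1 - a) = t powr (a - 1) * (c powr (a - 1) * c powr (1 - a))"
        using True c by (simp add: powr_mult)
      also have "c powr (a - 1) * c powr (1 - a) = 1" using c by (simp add: powr_add[symmetric])
      finally have e: "(c * t) powr (a - 1) * c powr (1 - a) = t powr (a - 1)" by simp
      have "(1 + c * t) * x = x + t * y" using xy by (simp add: c_def field_simps)
      hence "(c * t) powr (a - 1) / (1 + c * t) * (c powr (1 - a) / x)
          = ((c * t) powr (a - 1) * c powr (1 - a)) / (x + t * y)" by (simp add: times_divide_times_eq)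
      thus ?thesis using True c by (simp add: e zero_less_mult_iff)
    next
      case False
      thus ?thesis using c by (simp add: zero_less_mult_iff)
    qed
    moreover have "C /\<^sub>R \<bar>c\<bar> * (c powr (1 - a) / x) = C * (x powr (a - 1) * y powr (- a))"
    proof -
      have "c powr (1 - a) / c = c powr (- a)" using c powr_diff[of c "1 - a" 1] by simp
      also have "\<dots> = y powr (- a) * x powr a" using xy by (simp add: c_def powr_divide powr_minus field_simps)
      finally have "c powr (1 - a) / c / x = y powr (- a) * (x powr a / x)" by simp
      also have "x powr a / x = x powr (a - 1)" using xy powr_diff[of x a 1] by simp
      finally have e: "c powr (1 - a) / c / x = y powr (- a) * x powr (a - 1)" .
      have "C /\<^sub>R \<bar>c\<bar> * (c powr (1 - a) / x) = C * (c powr (1 - a) / c / x)"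
        using c by (simp add: divide_inverse mult_ac)
      thus ?thesis unfolding e by (simp only: mult_ac)
    qed
    ultimately show ?thesis by simp
  qed
  thus ?thesis using that C(1) by blast
qed

section \<open>Integrating the kernel inequalities\<close>

lemma dform_cong:
  assumes "pd n X" "pd n Y" "\<And>x y. 0 < x \<Longrightarrow> 0 < y \<Longrightarrow> h x y = g x y"
  shows "dform n h X Y K = dform n g X Y K"
  using assms pd_eigs(2) unfolding dform_def by (intro sum.cong refl) auto

lemma dform_mult: "dform n (\<lambda>x y. c * h x y) X Y K = c * dform n h X Y K"
  by (simp add: dform_def sum_distrib_left mult.assoc)

text \<open>For fixed \<open>X\<close> and \<open>Y\<close> the eigenvalues and coordinates do not
  depend on \<open>t\<close>, so the form is a finite linear combination of scalar integrals at
  positive pairs.\<close>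

lemma has_bochner_integral_dform:
  assumes "pd n X" "pd n Y"
    and h: "\<And>x y. 0 < x \<Longrightarrow> 0 < y \<Longrightarrow> has_bochner_integral lborel (\<lambda>t. h t x y) (H x y)"
  shows "has_bochner_integral lborel (\<lambda>t. dform n (h t) X Y K) (dform n H X Y K)"
  unfolding dform_def
  using assms(1,2) pd_eigs(2)
  by (intro has_bochner_integral_sum has_bochner_integral_mult_left h) auto

lemma has_bochner_integral_mono_real:
  fixes f g :: "'a \<Rightarrow> real"
  assumes "has_bochner_integral M f x" "has_bochner_integral M g y" "\<And>t. f t \<le> g t"
  shows "x \<le> y"
  using integral_mono[of M f g] assms by (auto simp: has_bochner_integral_iff)

text \<open>Multiplying the integral of 1 / (x + t y) by x y raises both exponents by 1 and produces
  the parallel kernel under a nonnegative weight. The constant \<open>C\<close> is the same for all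
  three pairs of matrices and can be divided out.\<close>

lemma dform_power_concave:
  assumes l: "0 \<le> l" "l \<le> 1" and X: "above_mix n l X0 X1 X2" and Y: "above_mix n l Y0 Y1 Y2"
    and K: "K \<in> carrier_mat n n" and p: "0 < p" "p < 1"
  defines "H \<equiv> \<lambda>x y. x powr p * y powr (1 - p)"
  shows "(1 - l) * dform n H X1 Y1 K + l * dform n H X2 Y2 K \<le> dform n H X0 Y0 K"
proof -
  obtain C where C: "0 < C" "\<And>x y. 0 < x \<Longrightarrow> 0 < y \<Longrightarrow> has_bochner_integral lborel
    (\<lambda>t. indicator {0<..} t * t powr (p - 1) * (1 / (x + t * y))) (C * (x powr (p - 1) * y powr (- p)))"
    using has_bochner_integral_scaled_power_kernel[OF p] by blast
  let ?w = "\<lambda>t::real. indicator {0<..} t * t powr (p - 1)"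
  have hb: "has_bochner_integral lborel (\<lambda>t. ?w t * (x * y / (x + t * y))) (C * H x y)"
    if "0 < x" "0 < y" for x y
  proof -
    have 1: "has_bochner_integral lborel (\<lambda>t. ?w t * (1 / (x + t * y)) * (x * y)) (C * (x powr (p - 1) * y powr (- p)) * (x * y))"
      by (intro has_bochner_integral_mult_left C that)
    have e: "x powr (p - 1) * x = x powr p" "y powr (- p) * y = y powr (1 - p)"
      using that powr_add[of x "p - 1" 1] powr_add[of y "- p" 1] by simp_all
    have "C * (x powr (p - 1) * y powr (- p)) * (x * y) = C * ((x powr (p - 1) * x) * (y powr (- p) * y))"
      by (simp only: mult_ac)
    hence 2: "C * (x powr (p - 1) * y powr (- p)) * (x * y) = C * H x y"
      by (simp only: e H_def)
    have 3: "?w t * (1 / (x + t * y)) * (x * y) = ?w t * (x * y / (x + t * y))" for t by simp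
    show ?thesis using 1 unfolding 2 3 .
  qed
  have int: "has_bochner_integral lborel (\<lambda>t. ?w t * dform n (\<lambda>x y. x * y / (x + t * y)) X Y K) (C * dform n H X Y K)"
    if "pd n X" "pd n Y" for X Y
    using has_bochner_integral_dform[OF that hb] unfolding dform_mult .
  have "(1 - l) * (C * dform n H X1 Y1 K) + l * (C * dform n H X2 Y2 K) \<le> C * dform n H X0 Y0 K"
  proof (rule has_bochner_integral_mono_real[OF has_bochner_integral_add[OF
        has_bochner_integral_mult_right has_bochner_integral_mult_right] int[OF above_mix_pd(1)[OF X] above_mix_pd(1)[OF Y]]])
    show "has_bochner_integral lborel (\<lambda>t. ?w t * dform n (\<lambda>x y. x * y / (x + t * y)) X1 Y1 K) (C * dform n H X1 Y1 K)"
      "has_bochner_integral lborel (\<lambda>t. ?w t * dform n (\<lambda>x y. x * y / (x + t * y)) X2 Y2 K) (C * dform n H X2 Y2 K)"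
      using above_mix_pd[OF X] above_mix_pd[OF Y] by (blast intro: int)+
    fix t :: real
    show "(1 - l) * (?w t * dform n (\<lambda>x y. x * y / (x + t * y)) X1 Y1 K) + l * (?w t * dform n (\<lambda>x y. x * y / (x + t * y)) X2 Y2 K)
      \<le> ?w t * dform n (\<lambda>x y. x * y / (x + t * y)) X0 Y0 K"
    proof (cases "0 < t")
      case True
      from mult_left_mono[OF parallel_kernel_concave[OF l X Y K True], of "t powr (p - 1)"]
      show ?thesis using True by (simp add: distrib_left mult.left_commute)
    qed simp
  qed
  hence "C * ((1 - l) * dform n H X1 Y1 K + l * dform n H X2 Y2 K) \<le> C * dform n H X0 Y0 K"
    by (simp add: distrib_left mult.left_commute)
  thus ?thesis using C(1) by simp
qed

lemma dform_power_convex: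
  assumes l: "0 \<le> l" "l \<le> 1" and X: "above_mix n l X0 X1 X2" and Y: "above_mix n l Y0 Y1 Y2"
    and K: "K \<in> carrier_mat n n" and p: "-1 < p" "p < 0"
  defines "H \<equiv> \<lambda>x y. x powr p * y powr (-1 - p)"
  shows "dform n H X0 Y0 K \<le> (1 - l) * dform n H X1 Y1 K + l * dform n H X2 Y2 K"
proof -
  \<comment> \<open>With a = p + 1 the formula represents the required powers directly, with no
    extra factor x y.\<close>
  have p': "0 < p + 1" "p + 1 < 1" using p by auto
  have e: "p + 1 - 1 = p" "- (p + 1) = -1 - p" by auto
  obtain C where C: "0 < C" "\<And>x y. 0 < x \<Longrightarrow> 0 < y \<Longrightarrow> has_bochner_integral lborel
    (\<lambda>t. indicator {0<..} t * t powr p * (1 / (x + t * y))) (C * H x y)"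
    using has_bochner_integral_scaled_power_kernel[OF p', unfolded e] unfolding H_def by blast
  let ?w = "\<lambda>t::real. indicator {0<..} t * t powr p"
  have int: "has_bochner_integral lborel (\<lambda>t. ?w t * dform n (\<lambda>x y. 1 / (x + t * y)) X Y K) (C * dform n H X Y K)"
    if "pd n X" "pd n Y" for X Y
    using has_bochner_integral_dform[OF that C(2)] unfolding dform_mult .
  have "C * dform n H X0 Y0 K \<le> (1 - l) * (C * dform n H X1 Y1 K) + l * (C * dform n H X2 Y2 K)"
  proof (rule has_bochner_integral_mono_real[OF int[OF above_mix_pd(1)[OF X] above_mix_pd(1)[OF Y]] has_bochner_integral_add[OF
        has_bochner_integral_mult_right has_bochner_integral_mult_right]])
    show "has_bochner_integral lborel (\<lambda>t. ?w t * dform n (\<lambda>x y. 1 / (x + t * y)) X1 Y1 K) (C * dform n H X1 Y1 K)"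
      "has_bochner_integral lborel (\<lambda>t. ?w t * dform n (\<lambda>x y. 1 / (x + t * y)) X2 Y2 K) (C * dform n H X2 Y2 K)"
      using above_mix_pd[OF X] above_mix_pd[OF Y] by (blast intro: int)+
    fix t :: real
    show "?w t * dform n (\<lambda>x y. 1 / (x + t * y)) X0 Y0 K
      \<le> (1 - l) * (?w t * dform n (\<lambda>x y. 1 / (x + t * y)) X1 Y1 K) + l * (?w t * dform n (\<lambda>x y. 1 / (x + t * y)) X2 Y2 K)"
    proof (cases "0 < t")
      case True
      from mult_left_mono[OF inverse_kernel_convex[OF l X Y K True], of "t powr p"]
      show ?thesis using True by (simp add: distrib_left mult.left_commute)
    qed simp
  qed
  hence "C * dform n H X0 Y0 K \<le> C * ((1 - l) * dform n H X1 Y1 K + l * dform n H X2 Y2 K)"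
    by (simp add: distrib_left mult.left_commute)
  thus ?thesis using C(1) by simp
qed

lemma continuous_on_dform_powr:
  assumes "pd n X" "pd n Y"
  shows "continuous_on S (\<lambda>p. dform n (\<lambda>x y. x powr p * y powr (c - p)) X Y K)"
proof -
  have "evals n X i \<noteq> 0" "evals n Y i \<noteq> 0" if "i < n" for i
    using pd_eigs(2)[OF assms(1) that] pd_eigs(2)[OF assms(2) that] by auto
  thus ?thesis unfolding dform_def by (intro continuous_intros) auto
qed

text \<open>On positive eigenvalues \<open>t powr 0\<close> is 1 anyway, so the separate clause for
  exponent 0 disappears and the value is given by one formula, continuous in the exponent.\<close>

lemma tform_rpow:
  assumes X: "pd n X" and Y: "pd n Y" and K: "K \<in> carrier_mat n n"
  shows "tform (mat_rpow X p) (mat_rpow Y q) K = dform n (\<lambda>x y. x powr p * y powr q) X Y K"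
  unfolding mat_rpow_def tform_mat_fun[OF assms] by (rule dform_cong[OF X Y]) auto

text \<open>The integral formula is available only for 0 < p < 1. For fixed matrices both sides are
  finite sums of powers of positive eigenvalues, hence continuous in \<open>p\<close>, and a weak
  inequality survives on the closure.\<close>

theorem lieb_concavity:
  assumes l: "0 \<le> l" "l \<le> 1" and X: "above_mix n l X0 X1 X2" and Y: "above_mix n l Y0 Y1 Y2"
    and K: "K \<in> carrier_mat n n" and p: "0 \<le> p" "p \<le> 1"
  shows "(1 - l) * tform (mat_rpow X1 p) (mat_rpow Y1 (1 - p)) K + l * tform (mat_rpow X2 p) (mat_rpow Y2 (1 - p)) K
    \<le> tform (mat_rpow X0 p) (mat_rpow Y0 (1 - p)) K"
proof -
  let ?D = "\<lambda>X Y p. dform n (\<lambda>x y. x powr p * y powr (1 - p)) X Y K"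
  note pd = above_mix_pd[OF X] above_mix_pd[OF Y]
  have "0 \<le> ?D X0 Y0 p - ((1 - l) * ?D X1 Y1 p + l * ?D X2 Y2 p)"
  proof (rule continuous_ge_on_closure[where x = p and S = "{0<..<1}"
        and f = "\<lambda>p. ?D X0 Y0 p - ((1 - l) * ?D X1 Y1 p + l * ?D X2 Y2 p)"])
    show "continuous_on (closure {0<..<1}) (\<lambda>p. ?D X0 Y0 p - ((1 - l) * ?D X1 Y1 p + l * ?D X2 Y2 p))"
      using pd by (intro continuous_intros continuous_on_dform_powr)
    show "p \<in> closure {0<..<1}" using p by simp
    show "0 \<le> ?D X0 Y0 p - ((1 - l) * ?D X1 Y1 p + l * ?D X2 Y2 p)" if "p \<in> {0<..<1}" for p
      using dform_power_concave[OF l X Y K, of p] that by simp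
  qed
  thus ?thesis using pd K by (simp add: tform_rpow)
qed

theorem lieb_convexity:
  assumes l: "0 \<le> l" "l \<le> 1" and X: "above_mix n l X0 X1 X2" and Y: "above_mix n l Y0 Y1 Y2"
    and K: "K \<in> carrier_mat n n" and p: "-1 \<le> p" "p \<le> 0"
  shows "tform (mat_rpow X0 p) (mat_rpow Y0 (-1 - p)) K
    \<le> (1 - l) * tform (mat_rpow X1 p) (mat_rpow Y1 (-1 - p)) K + l * tform (mat_rpow X2 p) (mat_rpow Y2 (-1 - p)) K"
proof -
  let ?D = "\<lambda>X Y p. dform n (\<lambda>x y. x powr p * y powr (-1 - p)) X Y K"
  note pd = above_mix_pd[OF X] above_mix_pd[OF Y]
  have "0 \<le> ((1 - l) * ?D X1 Y1 p + l * ?D X2 Y2 p) - ?D X0 Y0 p"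
  proof (rule continuous_ge_on_closure[where x = p and S = "{-1<..<0}"
        and f = "\<lambda>p. ((1 - l) * ?D X1 Y1 p + l * ?D X2 Y2 p) - ?D X0 Y0 p"])
    show "continuous_on (closure {-1<..<0}) (\<lambda>p. ((1 - l) * ?D X1 Y1 p + l * ?D X2 Y2 p) - ?D X0 Y0 p)"
      using pd by (intro continuous_intros continuous_on_dform_powr)
    show "p \<in> closure {-1<..<0}" using p by simp
    show "0 \<le> ((1 - l) * ?D X1 Y1 p + l * ?D X2 Y2 p) - ?D X0 Y0 p" if "p \<in> {-1<..<0}" for p
      using dform_power_convex[OF l X Y K, of p] that by simp
  qed
  thus ?thesis using pd K by (simp add: tform_rpow)
qed

section \<open>The case of a vanishing function, and the reduction of the theorem to positive
  definite images\<close>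

lemma mat_rpow_zero: "mat_rpow (0\<^sub>m n n) p = (if p = 0 then 1\<^sub>m n else 0\<^sub>m n n)"
proof -
  have z: "complex_of_real 0 \<cdot>\<^sub>m 1\<^sub>m n = 0\<^sub>m n n" by (rule eq_matI) auto
  have "complex_of_real 1 \<cdot>\<^sub>m 1\<^sub>m n = 1\<^sub>m n" by (rule eq_matI) auto
  thus ?thesis
    using mat_fun_scalar[of "\<lambda>t. if p = 0 then 1 else t powr p" 0 n] z by (simp add: mat_rpow_def)
qed

lemma mat_rpow_one: "mat_rpow (1\<^sub>m n) 0 = 1\<^sub>m n"
proof -
  have "complex_of_real 1 \<cdot>\<^sub>m 1\<^sub>m n = 1\<^sub>m n" by (rule eq_matI) auto
  thus ?thesis using mat_fun_scalar[of "\<lambda>t. if (0::real) = 0 then 1 else t powr 0" 1 n] by (simp add: mat_rpow_def)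
qed

text \<open>An operator monotone f vanishes identically or nowhere. In the degenerate case the convention
  X^0 = I allows the matrices to be replaced by the identity when p = 0.\<close>
lemma mapped_rpow_cases:
  assumes \<Phi>: "linear_mat_map k n \<Phi>" "positive_map k n \<Phi>" "unital_map k n \<Phi>"
    and f0: "\<forall>t>0. 0 \<le> f t" and f1: "operator_monotone_pos f"
  obtains (zero) "\<And>A. pd k A \<Longrightarrow> mat_rpow (\<Phi> (mat_fun f A)) p = 0\<^sub>m n n"
    | (mix) G where "\<And>A. pd k A \<Longrightarrow> mat_rpow (\<Phi> (mat_fun f A)) p = mat_rpow (G A) p"
      "\<And>A B l. pd k A \<Longrightarrow> pd k B \<Longrightarrow> 0 \<le> l \<Longrightarrow> l \<le> 1 \<Longrightarrow>
        above_mix n l (G (complex_of_real (1 - l) \<cdot>\<^sub>m A + complex_of_real l \<cdot>\<^sub>m B)) (G A) (G B)"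
proof -
  have f: "operator_monotone_pos f" "\<And>t. 0 < t \<Longrightarrow> 0 \<le> f t" using f0 f1 by auto
  show ?thesis
  proof (cases "\<forall>t>0. 0 < f t")
    case True
    have pd: "pd n (\<Phi> (mat_fun f A))" if A: "pd k A" for A
    proof (rule unital_positive_pd[OF \<Phi>])
      obtain U d where "spectral k A U d" "\<And>i. i < k \<Longrightarrow> 0 < d i" using pd_spectral[OF A] by blast
      thus "pd k (mat_fun f A)" using True by (intro spectral_pos_pd[OF spectral_mat_fun]) auto
    qed
    show ?thesis
    proof (rule mix[of "\<lambda>A. \<Phi> (mat_fun f A)"])
      fix A B :: "complex mat" and l :: real assume "pd k A" "pd k B" "0 \<le> l" "l \<le> 1"
      thus "above_mix n l (\<Phi> (mat_fun f (complex_of_real (1 - l) \<cdot>\<^sub>m A + complex_of_real l \<cdot>\<^sub>m B)))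
          (\<Phi> (mat_fun f A)) (\<Phi> (mat_fun f B))"
        unfolding above_mix_def
        using positive_map_mat_fun_concave[OF \<Phi>(1,2) f] by (intro conjI pd pd_convex) auto
    qed simp
  next
    case False
    hence f0: "\<And>t. 0 < t \<Longrightarrow> f t = 0" using operator_monotone_zero_or_pos[OF f] by blast
    have "\<Phi> (mat_fun f A) = 0\<^sub>m n n" if A: "pd k A" for A
    proof -
      obtain U d where s: "spectral k A U d" "\<And>i. i < k \<Longrightarrow> 0 < d i" using pd_spectral[OF A] by blast
      have U: "U \<in> carrier_mat k k" using s(1) by (auto simp: spectral_def unitary_def)
      have "rdiag k (\<lambda>i. f (d i)) = 0\<^sub>m k k" by (rule eq_matI) (use f0 s(2) in auto)
      hence "mat_fun f A = 0\<^sub>m k k" unfolding mat_fun_spectral[OF s(1)] using U by simp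
      \<comment> \<open>Written as a multiple of the identity, the zero matrix has an image that
        follows from homogeneity and unitality.\<close>
      also have "\<dots> = 0 \<cdot>\<^sub>m 1\<^sub>m k" by (rule eq_matI) auto
      also have "\<Phi> \<dots> = 0 \<cdot>\<^sub>m 1\<^sub>m n"
        using \<Phi>(3) by (simp add: linear_mat_mapD(3)[OF \<Phi>(1)] unital_map_def)
      also have "\<dots> = 0\<^sub>m n n" by (rule eq_matI) auto
      finally show ?thesis .
    qed
    \<comment> \<open>\<open>0 powr p\<close> is 0 for every nonzero \<open>p\<close>, negative ones
      included. So in the convex case too, a vanishing function makes its factor zero unless the
      exponent is 0.\<close>
    hence rpow: "mat_rpow (\<Phi> (mat_fun f A)) p = (if p = 0 then 1\<^sub>m n else 0\<^sub>m n n)" if "pd k A" for A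
      using that by (simp add: mat_rpow_zero)
    show ?thesis
    proof (cases "p = 0")
      case True
      show ?thesis
      proof (rule mix[of "\<lambda>_. 1\<^sub>m n"])
        fix l :: real
        have "1\<^sub>m n - (complex_of_real (1 - l) \<cdot>\<^sub>m 1\<^sub>m n + complex_of_real l \<cdot>\<^sub>m 1\<^sub>m n) = complex_of_real 0 \<cdot>\<^sub>m 1\<^sub>m n"
          by (rule eq_matI) auto
        hence "psd n (1\<^sub>m n - (complex_of_real (1 - l) \<cdot>\<^sub>m 1\<^sub>m n + complex_of_real l \<cdot>\<^sub>m 1\<^sub>m n))"
          using spectral_nonneg_psd[OF spectral_scalar[of n 0]] by simp
        thus "above_mix n l (1\<^sub>m n) (1\<^sub>m n) (1\<^sub>m n)" by (simp add: above_mix_def pd_one)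
      qed (use True rpow mat_rpow_one in auto)
    qed (use rpow zero in auto)
  qed
qed

lemma mat_rpow_carrier: "pd n X \<Longrightarrow> mat_rpow X p \<in> carrier_mat n n"
  unfolding mat_rpow_def using pd_spectral spectral_mat_fun spectral_carrier by metis

lemma tform_zero:
  assumes "Y \<in> carrier_mat n n" "K \<in> carrier_mat n n"
  shows "tform (0\<^sub>m n n) Y K = 0" "tform Y (0\<^sub>m n n) K = 0"
  using assms by (auto simp: tform_def mtrace_def)

theorem theorem3p9:
  fixes k m n :: nat
    and \<Phi> \<Psi> :: "complex mat \<Rightarrow> complex mat"
    and K :: "complex mat"
    and f1 f2 :: "real \<Rightarrow> real"
  assumes \<Phi>: "linear_mat_map k n \<Phi>" "positive_map k n \<Phi>" "unital_map k n \<Phi>"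
    and \<Psi>: "linear_mat_map m n \<Psi>" "positive_map m n \<Psi>" "unital_map m n \<Psi>"
    and K: "K \<in> carrier_mat n n"
    and f1: "\<forall>t>0. f1 t \<ge> 0" "operator_monotone_pos f1"
    and f2: "\<forall>t>0. f2 t \<ge> 0" "operator_monotone_pos f2"
  shows "(\<forall>p::real. 0 \<le> p \<and> p \<le> 1 \<longrightarrow>
            jointly_concave_on {A. pd k A} {B. pd m B}
              (\<lambda>A B. Re (mtrace (mat_rpow (\<Phi> (mat_fun f1 A)) p * cadj K
                                  * mat_rpow (\<Psi> (mat_fun f2 B)) (1 - p) * K))))
       \<and> (\<forall>p::real. -1 \<le> p \<and> p \<le> 0 \<longrightarrow>
            jointly_convex_on {A. pd k A} {B. pd m B}
              (\<lambda>A B. Re (mtrace (mat_rpow (\<Phi> (mat_fun f1 A)) p * cadj K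
                                  * mat_rpow (\<Psi> (mat_fun f2 B)) (-1 - p) * K))))"
proof -
  let ?T = "\<lambda>p q A B. tform (mat_rpow (\<Phi> (mat_fun f1 A)) p) (mat_rpow (\<Psi> (mat_fun f2 B)) q) K"
  \<comment> \<open>Either some factor is zero for all arguments and the required inequality reads 0
    \<le> 0, or \<open>G\<close> and \<open>H\<close> are families with the same powers to which the
    two Lieb theorems apply. They may depend on the exponents, which are fixed first.\<close>
  have reduce: "(\<forall>A B. pd k A \<longrightarrow> pd m B \<longrightarrow> ?T p q A B = 0) \<or>
    (\<exists>G H. (\<forall>A B. pd k A \<longrightarrow> pd m B \<longrightarrow> ?T p q A B = tform (mat_rpow (G A) p) (mat_rpow (H B) q) K)
      \<and> (\<forall>A1 A2 l. pd k A1 \<and> pd k A2 \<and> 0 \<le> l \<and> l \<le> 1 \<longrightarrow>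
          above_mix n l (G (complex_of_real (1 - l) \<cdot>\<^sub>m A1 + complex_of_real l \<cdot>\<^sub>m A2)) (G A1) (G A2))
      \<and> (\<forall>B1 B2 l. pd m B1 \<and> pd m B2 \<and> 0 \<le> l \<and> l \<le> 1 \<longrightarrow>
          above_mix n l (H (complex_of_real (1 - l) \<cdot>\<^sub>m B1 + complex_of_real l \<cdot>\<^sub>m B2)) (H B1) (H B2)))"
    (is "?Z \<or> ?M") for p q
  proof -
    \<comment> \<open>The relation for the pair A, A with l = 0 contains the positive definiteness
      of \<open>G A\<close>, and with it the dimensions of its powers.\<close>
    have mixc: "mat_rpow (G A) r \<in> carrier_mat n n"
      if "\<And>A B l. pd j A \<Longrightarrow> pd j B \<Longrightarrow> 0 \<le> l \<Longrightarrow> l \<le> 1 \<Longrightarrow>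
        above_mix n l (G (complex_of_real (1 - l) \<cdot>\<^sub>m A + complex_of_real l \<cdot>\<^sub>m B)) (G A) (G B)" "pd j A"
      for G :: "complex mat \<Rightarrow> complex mat" and j r A
      using mat_rpow_carrier above_mix_pd(2)[OF that(1)[OF that(2,2), of 0]] by simp
    show ?thesis
    proof (cases rule: mapped_rpow_cases[OF \<Phi> f1, of p, case_names zero mix])
      case z1: zero
      show ?thesis
      proof (cases rule: mapped_rpow_cases[OF \<Psi> f2, of q, case_names zero mix])
        case zero
        hence ?Z using z1 K by (simp add: tform_zero)
        thus ?thesis ..
      next
        case (mix H)
        hence ?Z using z1 K mixc[of m H] by (simp add: tform_zero)
        thus ?thesis ..
      qed
    next
      case m1: (mix G)
      show ?thesis
      proof (cases rule: mapped_rpow_cases[OF \<Psi> f2, of q, case_names zero mix])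
        case zero
        hence ?Z using m1 K mixc[of k G] by (simp add: tform_zero)
        thus ?thesis ..
      next
        case (mix H)
        hence ?M using m1 by (intro exI[of _ G] exI[of _ H]) auto
        thus ?thesis ..
      qed
    qed
  qed
  show ?thesis
    unfolding jointly_concave_on_def jointly_convex_on_def tform_def[symmetric]
  proof (intro conjI allI ballI impI)
    fix p l :: real and A1 A2 B1 B2
    assume p: "0 \<le> p \<and> p \<le> 1" and l: "0 \<le> l \<and> l \<le> 1"
      and "A1 \<in> {A. pd k A}" "A2 \<in> {A. pd k A}" "B1 \<in> {B. pd m B}" "B2 \<in> {B. pd m B}"
    hence pd: "pd k A1" "pd k A2" "pd m B1" "pd m B2" by auto
    let ?A = "complex_of_real (1 - l) \<cdot>\<^sub>m A1 + complex_of_real l \<cdot>\<^sub>m A2"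
      and ?B = "complex_of_real (1 - l) \<cdot>\<^sub>m B1 + complex_of_real l \<cdot>\<^sub>m B2"
    have pd0: "pd k ?A" "pd m ?B" using pd l by (auto intro!: pd_convex simp del: of_real_diff)
    show "(1 - l) * ?T p (1 - p) A1 B1 + l * ?T p (1 - p) A2 B2 \<le> ?T p (1 - p) ?A ?B"
      using reduce[of p "1 - p"]
    proof (elim disjE exE conjE)
      fix G H
      assume eq: "\<forall>A B. pd k A \<longrightarrow> pd m B \<longrightarrow> ?T p (1 - p) A B = tform (mat_rpow (G A) p) (mat_rpow (H B) (1 - p)) K"
        and GH: "\<forall>A1 A2 l. pd k A1 \<and> pd k A2 \<and> 0 \<le> l \<and> l \<le> 1 \<longrightarrow>
          above_mix n l (G (complex_of_real (1 - l) \<cdot>\<^sub>m A1 + complex_of_real l \<cdot>\<^sub>m A2)) (G A1) (G A2)"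
        "\<forall>B1 B2 l. pd m B1 \<and> pd m B2 \<and> 0 \<le> l \<and> l \<le> 1 \<longrightarrow>
          above_mix n l (H (complex_of_real (1 - l) \<cdot>\<^sub>m B1 + complex_of_real l \<cdot>\<^sub>m B2)) (H B1) (H B2)"
      have "above_mix n l (G ?A) (G A1) (G A2)" "above_mix n l (H ?B) (H B1) (H B2)" using GH pd l by blast+
      from lieb_concavity[OF _ _ this K, of p] eq[rule_format, OF pd0] eq[rule_format, OF pd(1,3)]
        eq[rule_format, OF pd(2,4)] l p
      show ?thesis by simp
    qed (use pd pd0 in simp)
  next
    fix p l :: real and A1 A2 B1 B2
    assume p: "-1 \<le> p \<and> p \<le> 0" and l: "0 \<le> l \<and> l \<le> 1"
      and "A1 \<in> {A. pd k A}" "A2 \<in> {A. pd k A}" "B1 \<in> {B. pd m B}" "B2 \<in> {B. pd m B}"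
    hence pd: "pd k A1" "pd k A2" "pd m B1" "pd m B2" by auto
    let ?A = "complex_of_real (1 - l) \<cdot>\<^sub>m A1 + complex_of_real l \<cdot>\<^sub>m A2"
      and ?B = "complex_of_real (1 - l) \<cdot>\<^sub>m B1 + complex_of_real l \<cdot>\<^sub>m B2"
    have pd0: "pd k ?A" "pd m ?B" using pd l by (auto intro!: pd_convex simp del: of_real_diff)
    show "?T p (-1 - p) ?A ?B \<le> (1 - l) * ?T p (-1 - p) A1 B1 + l * ?T p (-1 - p) A2 B2"
      using reduce[of p "-1 - p"]
    proof (elim disjE exE conjE)
      fix G H
      assume eq: "\<forall>A B. pd k A \<longrightarrow> pd m B \<longrightarrow> ?T p (-1 - p) A B = tform (mat_rpow (G A) p) (mat_rpow (H B) (-1 - p)) K"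
        and GH: "\<forall>A1 A2 l. pd k A1 \<and> pd k A2 \<and> 0 \<le> l \<and> l \<le> 1 \<longrightarrow>
          above_mix n l (G (complex_of_real (1 - l) \<cdot>\<^sub>m A1 + complex_of_real l \<cdot>\<^sub>m A2)) (G A1) (G A2)"
        "\<forall>B1 B2 l. pd m B1 \<and> pd m B2 \<and> 0 \<le> l \<and> l \<le> 1 \<longrightarrow>
          above_mix n l (H (complex_of_real (1 - l) \<cdot>\<^sub>m B1 + complex_of_real l \<cdot>\<^sub>m B2)) (H B1) (H B2)"
      have "above_mix n l (G ?A) (G A1) (G A2)" "above_mix n l (H ?B) (H B1) (H B2)" using GH pd l by blast+
      from lieb_convexity[OF _ _ this K, of p] eq[rule_format, OF pd0] eq[rule_format, OF pd(1,3)]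
        eq[rule_format, OF pd(2,4)] l p
      show ?thesis by simp
    qed (use pd pd0 in simp)
  qed
qed

end
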